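(* If $\Gamma$ is a finite connected $3$-valent vertex-transitive graph, then every automorphism of $\Gamma$ fixing a vertex has order at most $6$; that is, ${\rm meo}(\mathrm{Aut}(\Gamma)_v)\le 6$ for every vertex $v$.
   Context: ${\rm meo}(H)$ denotes the maximal order of an element of a group $H$; $\mathrm{Aut}(\Gamma)_v$ is the stabiliser of the vertex $v$ in $\mathrm{Aut}(\Gamma)$. *)

theory Defs
  imports
    "Graph_Theory.Graph_Theory"
    "HOL-Algebra.Algebra"
begin

text \<open>
  A finite simple graph is a \<^locale>\<open>pair_graph\<close>: a finite vertex set together with a symmetric
  irreflexive set of arcs, each edge contributing its two opposite arcs. Hence the valency of a
  vertex is its out-degree.
\<close>

definition k_valent :: "nat \<Rightarrow> 'a pair_pre_digraph \<Rightarrow> bool" where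
  "k_valent k G \<longleftrightarrow> (\<forall>v \<in> pverts G. out_degree (with_proj G) v = k)"

text \<open>
  As everywhere in \<^const>\<open>BijGroup\<close>, automorphisms are extensional functions, i.e. \<^const>\<open>undefined\<close>
  off the vertex set, so that they correspond one-to-one to permutations of the vertices.
\<close>

definition graph_auts :: "'a pair_pre_digraph \<Rightarrow> ('a \<Rightarrow> 'a) set" where
  "graph_auts G =
     {f \<in> Bij (pverts G).
        \<forall>u \<in> pverts G. \<forall>v \<in> pverts G. (f u, f v) \<in> parcs G \<longleftrightarrow> (u, v) \<in> parcs G}"

definition Aut :: "'a pair_pre_digraph \<Rightarrow> ('a \<Rightarrow> 'a) monoid" where
  "Aut G = BijGroup (pverts G) \<lparr>carrier := graph_auts G\<rparr>"

definition Aut_stab :: "'a pair_pre_digraph \<Rightarrow> 'a \<Rightarrow> ('a \<Rightarrow> 'a) monoid" where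
  "Aut_stab G v = Aut G \<lparr>carrier := stabilizer (Aut G) (\<lambda>g. g) v\<rparr>"

definition vertex_transitive :: "'a pair_pre_digraph \<Rightarrow> bool" where
  "vertex_transitive G \<longleftrightarrow>
     (\<forall>u \<in> pverts G. \<forall>v \<in> pverts G. \<exists>g \<in> carrier (Aut G). g u = v)"

text \<open>
  Meaningful for finite groups only: \<^const>\<open>Max\<close> is unspecified on infinite sets, and
  \<^const>\<open>group.ord\<close> is \<open>0\<close> on elements of infinite order.
\<close>

definition meo :: "('a, 'b) monoid_scheme \<Rightarrow> nat" where
  "meo H = Max (group.ord H ` carrier H)"

lemma subgroup_graph_auts: "subgroup (graph_auts G) (BijGroup (pverts G))"
proof (rule group.subgroupI[OF group_BijGroup])
  show "graph_auts G \<subseteq> carrier (BijGroup (pverts G))"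
    by (auto simp: graph_auts_def BijGroup_def)
  have "(\<lambda>x \<in> pverts G. x) \<in> graph_auts G"
    by (auto simp: graph_auts_def id_Bij)
  then show "graph_auts G \<noteq> {}" by blast
next
  fix f assume f: "f \<in> graph_auts G"
  then have B: "f \<in> Bij (pverts G)" by (simp add: graph_auts_def)
  then have bij: "bij_betw f (pverts G) (pverts G)" by (simp add: Bij_def)
  have "(inv_into (pverts G) f u, inv_into (pverts G) f v) \<in> parcs G \<longleftrightarrow> (u, v) \<in> parcs G"
    if uv: "u \<in> pverts G" "v \<in> pverts G" for u v
  proof -
    have "inv_into (pverts G) f u \<in> pverts G" "inv_into (pverts G) f v \<in> pverts G"
      using uv B by (auto intro: Bij_inv_into_mem)
    moreover have "f (inv_into (pverts G) f u) = u" "f (inv_into (pverts G) f v) = v"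
      using uv bij by (auto simp: bij_betw_inv_into_right)
    ultimately show ?thesis using f by (force simp: graph_auts_def)
  qed
  then show "inv\<^bsub>BijGroup (pverts G)\<^esub> f \<in> graph_auts G"
    using B by (auto simp: inv_BijGroup graph_auts_def restrict_inv_into_Bij)
next
  fix f g assume fg: "f \<in> graph_auts G" "g \<in> graph_auts G"
  then have B: "f \<in> Bij (pverts G)" "g \<in> Bij (pverts G)" by (auto simp: graph_auts_def)
  then have "g x \<in> pverts G" if "x \<in> pverts G" for x
    using that Bij_imp_funcset by blast
  then show "f \<otimes>\<^bsub>BijGroup (pverts G)\<^esub> g \<in> graph_auts G"
    using fg B by (auto simp: BijGroup_def graph_auts_def compose_Bij compose_eq)
qed

lemma group_Aut: "group (Aut G)"
  unfolding Aut_def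
  by (rule subgroup.subgroup_is_group[OF subgroup_graph_auts group_BijGroup])

lemma group_action_Aut: "group_action (Aut G) (pverts G) (\<lambda>g. g)"
proof -
  have "(\<lambda>g. g) \<in> hom (Aut G) (BijGroup (pverts G))"
    using subgroup.subset[OF subgroup_graph_auts[of G]]
    by (auto simp: hom_def Aut_def)
  then show ?thesis
    by (simp add: group_action_def group_hom_def group_hom_axioms_def group_Aut group_BijGroup)
qed

lemma group_Aut_stab:
  assumes "v \<in> pverts G"
  shows "group (Aut_stab G v)"
  unfolding Aut_stab_def
  using group_action.stabilizer_subgroup[OF group_action_Aut assms] group_Aut
  by (rule subgroup.subgroup_is_group)

lemma finite_Aut_stab:
  assumes "finite (pverts G)"
  shows "finite (carrier (Aut_stab G v))"
proof (rule finite_subset)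
  show "carrier (Aut_stab G v) \<subseteq> pverts G \<rightarrow>\<^sub>E pverts G"
  proof
    fix g assume "g \<in> carrier (Aut_stab G v)"
    then have "g \<in> Bij (pverts G)"
      by (simp add: Aut_stab_def stabilizer_def Aut_def graph_auts_def)
    then show "g \<in> pverts G \<rightarrow>\<^sub>E pverts G"
      unfolding PiE_def using Bij_imp_funcset Bij_imp_extensional by blast
  qed
  show "finite (pverts G \<rightarrow>\<^sub>E pverts G)"
    using assms by (intro finite_PiE) auto
qed

end

(*
  Let P be the stabiliser of an arc if the automorphism group is transitive on arcs, and of a vertex
  otherwise; we may assume that it acts nontrivially on the next step of a walk. Following a shunt t along a line in the graph yields involutions
  x_i = t^i x_0 t^-i such that x_a, ..., x_b generate the pointwise stabiliser W a b of a path, of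
  order 2^(b - a + 1), and P = W 0 (n - 1). Let m be least with w = [x_0, x_m] nontrivial and let x_r
  be the first factor of w. The commutator of w with y = x_(m+r) is a conjugate u of w, and that of u
  with x_0 is w again, so x_0 y would act with order 3 on <w, u> inside a 2-group; hence n <= m + r.
  It then follows that A = W 0 (m - 1) is normal in P = B A with A and B elementary abelian, so P has
  exponent dividing 4.

  In the arc-transitive case x_0 and x_n generate a group moving the neighbours of a vertex v like
  S_3, which forces n <= m + 1. Then the kernel of the action on the neighbours of v is elementary
  abelian, and an element rotating the three neighbours satisfies g^6 = 1.
*)
theory Submission
  imports Defs "HOL-Combinatorics.Perm"
begin

unbundle permutation_syntax

section \<open>Chains of involutions\<close>

text \<open>No bound on \<open>n\<close> can be expected: cubic vertex-transitive graphs that are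
  not arc-transitive can have arbitrarily large vertex stabilisers, so there is no finite list of
  stabilisers to inspect. The argument must be uniform in \<open>n\<close>, and it yields orders
  dividing 4 or 6. The 4 is the exponent bound for an extension of one elementary abelian 2-group by
  another; the 6 is 3 for a rotation of the neighbours times 2 for the kernel. The obstacle is
  reversal. A group element realises the reversal of a path on \<open>n + 1\<close> darts only, not
  on the whole line, so symmetry arguments about the \<open>x i\<close> have to stay within the
  indices from 0 to \<open>m\<close>.\<close>

lemma perm_cancel [simp]:
  fixes g h :: "'a perm"
  shows "inverse g * (g * h) = h" "g * (inverse g * h) = h"
  by (simp_all flip: mult.assoc)

lemma perm_conj_eq_iff:
  fixes g h k :: "'a perm"
  shows "g * h * inverse g = k \<longleftrightarrow> g * h = k * g"
  by (metis mult.assoc mult.right_neutral perm.left_inverse perm.right_inverse)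

lemma perm_conj_commute:
  fixes t g h :: "'a perm"
  shows "(t * g * inverse t) * (t * h * inverse t) = (t * h * inverse t) * (t * g * inverse t)
    \<longleftrightarrow> g * h = h * g"
  using perm.right_cancel[of "g * h" "inverse t" "h * g"] by (simp add: mult.assoc perm.left_cancel)

lemma perm_conj_power:
  fixes t g :: "'a perm"
  shows "(t * g * inverse t) ^ k = t * g ^ k * inverse t"
  by (induction k) (simp_all add: mult.assoc)

lemma obtain_last_int:
  fixes a b :: int
  assumes "P a" "\<not> P b" "a \<le> b"
  obtains r where "a \<le> r" "r < b" "P r" "\<not> P (r + 1)"
proof -
  have "\<exists>r. a \<le> r \<and> r < b \<and> P r \<and> \<not> P (r + 1)"
  proof (rule ccontr)
    assume *: "\<not> ?thesis"
    have "c \<le> b \<longrightarrow> P c" if "a \<le> c" for c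
      using that by (induction c rule: int_ge_induct) (use assms * in auto)
    with assms show False by blast
  qed
  with that show thesis by blast
qed

text \<open>
  Abstracts the action of a group along a bi-infinite path \<open>\<omega>\<close> with shift \<open>t\<close>:
  \<open>W a b\<close> is the pointwise stabiliser of \<open>\<omega>\<^sub>i\<close> for \<open>b \<le> i < a + n\<close>, a path which \<^emph>\<open>grows\<close> as \<open>a\<close>
  increases or \<open>b\<close> decreases, and \<open>\<rho>\<close> reverses a path of length \<open>n\<close>. The reversal need not
  invert \<open>t\<close>, but only up to a factor from \<open>W 1 1\<close>.
\<close>

locale involution_chain =
  fixes n :: int
    and x :: "int \<Rightarrow> 'a perm"
    and W :: "int \<Rightarrow> int \<Rightarrow> 'a perm set"
    and t \<rho> :: "'a perm"
  assumes n_pos: "0 < n"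
    and W_one: "1 \<in> W a b"
    and W_mult: "g \<in> W a b \<Longrightarrow> h \<in> W a b \<Longrightarrow> g * h \<in> W a b"
    and W_mono: "a' \<le> a \<Longrightarrow> b \<le> b' \<Longrightarrow> W a b \<subseteq> W a' b'"
    and W_Int: "g \<in> W a b \<Longrightarrow> g \<in> W a' b' \<Longrightarrow> a \<le> a' \<Longrightarrow> b \<le> b' \<Longrightarrow> b' \<le> a + n \<Longrightarrow> g \<in> W a' b"
    and W_trivial: "g \<in> W a b \<Longrightarrow> b < a \<Longrightarrow> g = 1"
    and x_mem: "x i \<in> W i i"
    and W_left: "g \<in> W a b \<Longrightarrow> a \<le> b \<Longrightarrow> b < a + n \<Longrightarrow> g \<in> W a (b - 1) \<or> x b * g \<in> W a (b - 1)"
    and W_right: "g \<in> W a b \<Longrightarrow> a \<le> b \<Longrightarrow> b < a + n \<Longrightarrow> g \<in> W (a + 1) b \<or> x a * g \<in> W (a + 1) b"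
    and W_commutator: "g \<in> W a b \<Longrightarrow> h \<in> W a b \<Longrightarrow> b < a + n \<Longrightarrow>
      g * h * inverse g * inverse h \<in> W (a + 1) (b - 1)"
    and W_square: "g \<in> W a b \<Longrightarrow> b < a + n \<Longrightarrow> g * g \<in> W (a + 1) (b - 1)"
    and W_shift: "t * g * inverse t \<in> W (a + 1) (b + 1) \<longleftrightarrow> g \<in> W a b"
    and x_shift: "t * x i * inverse t = x (i + 1)"
    and refl_0: "\<rho> * x 0 * inverse \<rho> = x 1"
    and refl_1: "\<rho> * x 1 * inverse \<rho> = x 0"
    and refl_shift: "t * \<rho> * t * inverse \<rho> \<in> {1, x 1}"
begin

lemma x_in: "a \<le> i \<Longrightarrow> i \<le> b \<Longrightarrow> x i \<in> W a b"
  using W_mono x_mem by blast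

lemma x_square [simp]: "x i * x i = 1"
  using W_square[OF x_mem] W_trivial n_pos by force

lemma x_cancel [simp]: "x i * (x i * g) = g"
  by (simp flip: mult.assoc)

lemma x_inverse [simp]: "inverse (x i) = x i"
  by (rule perm.inverse_unique) simp

lemma shift_power: "t ^ k * x i * inverse (t ^ k) = x (i + int k)"
proof (induction k)
  case (Suc k)
  have "t ^ Suc k * x i * inverse (t ^ Suc k) = t * (t ^ k * x i * inverse (t ^ k)) * inverse t"
    by (simp add: mult.assoc)
  then show ?case by (simp only: Suc x_shift) (simp add: ac_simps)
qed simp

lemma W_shift_power: "t ^ k * g * inverse (t ^ k) \<in> W (a + int k) (b + int k) \<longleftrightarrow> g \<in> W a b"
proof (induction k)
  case (Suc k)
  have "t ^ Suc k * g * inverse (t ^ Suc k) = t * (t ^ k * g * inverse (t ^ k)) * inverse t"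
    by (simp add: mult.assoc)
  then show ?case
    using W_shift[of "t ^ k * g * inverse (t ^ k)" "a + int k" "b + int k"] Suc
    by (simp add: ac_simps)
qed simp

lemma x_commute_shift: "x (i + 1) * x (j + 1) = x (j + 1) * x (i + 1) \<longleftrightarrow> x i * x j = x j * x i"
  using perm_conj_commute[of t "x i" "x j"] by (simp add: x_shift)

lemma x_commute_translate: "x (i + k) * x (j + k) = x (j + k) * x (i + k) \<longleftrightarrow> x i * x j = x j * x i"
proof (induction k rule: int_induct[where k = 0])
  case (step1 k)
  then show ?case using x_commute_shift[of "i + k" "j + k"] by (simp add: add.assoc)
next
  case (step2 k)
  then show ?case using x_commute_shift[of "i + (k - 1)" "j + (k - 1)"] by simp
qed simp

lemma commutator_shift:
  assumes "x j * x q * x j * x q \<in> W a b"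
  shows "x (j + 1) * x (q + 1) * x (j + 1) * x (q + 1) \<in> W (a + 1) (b + 1)"
proof -
  have "x (j + 1) * x (q + 1) * x (j + 1) * x (q + 1) = t * (x j * x q * x j * x q) * inverse t"
    by (simp add: mult.assoc flip: x_shift)
  with assms show ?thesis by (simp only: W_shift)
qed

text \<open>\<open>W_left\<close> peels off the top index, so every element is a product of some
  \<open>x i\<close> whose indices decrease from left to right.\<close>

lemma W_induct [consumes 2, case_names one mult]:
  assumes "g \<in> W a b" "b < a + n"
    and one: "Q 1"
    and step: "\<And>i h. a \<le> i \<Longrightarrow> i \<le> b \<Longrightarrow> h \<in> W a i \<Longrightarrow> Q h \<Longrightarrow> Q (x i * h)"
  shows "Q g"
  using assms(1,2) step
proof (induction "nat (b - a + 1)" arbitrary: b g)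
  case 0
  then show ?case using W_trivial one by fastforce
next
  case (Suc k)
  have ab: "a \<le> b" and k: "k = nat (b - 1 - a + 1)" and b: "b - 1 < a + n"
    using Suc.hyps(2) Suc.prems(2) by linarith+
  have IH: "Q h" if "h \<in> W a (b - 1)" for h
    by (rule Suc.hyps(1)[OF k that b]) (use Suc.prems(3) in force)
  from W_left[OF Suc.prems(1) ab Suc.prems(2)] show ?case
  proof
    assume h: "x b * g \<in> W a (b - 1)"
    have "Q (x b * (x b * g))"
      using h W_mono[of a a "b - 1" b] by (intro Suc.prems(3) IH ab) auto
    then show ?case by simp
  qed (rule IH)
qed

lemma commute_W:
  assumes "g \<in> W a b" "b < a + n" "\<And>i. a \<le> i \<Longrightarrow> i \<le> b \<Longrightarrow> y * x i = x i * y"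
  shows "y * g = g * y"
  using assms(1,2)
proof (induction rule: W_induct)
  case (mult i h)
  then show ?case using assms(3)[of i] by (metis mult.assoc)
qed simp

text \<open>Squaring shortens the index range at both ends, so repeated squaring ends in the trivial
  group.\<close>

lemma W_power_of_2:
  assumes "g \<in> W a b" "b < a + n"
  shows "\<exists>k. g ^ (2 ^ k) = 1"
  using assms
proof (induction "nat (b - a + 1)" arbitrary: g a b rule: less_induct)
  case less
  show ?case
  proof (cases "b < a")
    case True
    then show ?thesis using less.prems W_trivial by fastforce
  next
    case False
    have "\<exists>k. (g * g) ^ (2 ^ k) = 1"
      using False less.prems by (intro less.hyps[OF _ W_square]) auto
    then obtain k where "(g * g) ^ (2 ^ k) = 1" by blast
    then have "g ^ (2 ^ Suc k) = 1"
      by (simp add: power_mult power2_eq_square)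
    then show ?thesis by blast
  qed
qed

end

text \<open>
  The parameter \<open>m\<close> is the least distance of two noncommuting \<open>x i\<close>, or \<open>n\<close> if all those occurring
  in \<open>W 0 (n - 1)\<close> commute.
\<close>

locale commuting_chain = involution_chain +
  fixes m :: int
  assumes m_pos: "0 < m" and m_le: "m \<le> n"
    and commute_0: "0 \<le> j \<Longrightarrow> j < m \<Longrightarrow> x 0 * x j = x j * x 0"
    and noncommute: "m < n \<Longrightarrow> x 0 * x m \<noteq> x m * x 0"
begin

lemma x_commute: "\<bar>i - j\<bar> < m \<Longrightarrow> x i * x j = x j * x i"
  using commute_0[of "j - i"] commute_0[of "i - j"]
    x_commute_translate[of 0 i "j - i"] x_commute_translate[of 0 j "i - j"]
  by (cases "i \<le> j") auto

lemma commute_near: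
  assumes "g \<in> W a b" "b < a + n" "j - m < a" "b < j + m"
  shows "x j * g = g * x j"
  using assms(1,2) by (rule commute_W) (intro x_commute, use assms in auto)

lemma W_abelian:
  assumes "g \<in> W a b" "h \<in> W a b" "b < a + m"
  shows "g * h = h * g"
proof (rule commute_W[OF assms(2)])
  show "b < a + n" using assms m_le by simp
  show "g * x i = x i * g" if "a \<le> i" "i \<le> b" for i
    using commute_near[OF assms(1), of i] that assms(3) m_le by simp
qed

lemma W_commute:
  assumes "g \<in> W a b" "h \<in> W a' b'" "b < a + n" "b' < a' + n" "b' < a + m" "b < a' + m"
  shows "g * h = h * g"
proof (rule commute_W[OF assms(2,4)])
  show "g * x i = x i * g" if "a' \<le> i" "i \<le> b'" for i
    using commute_near[OF assms(1), of i] that assms by simp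
qed

lemma W_elementary:
  assumes "g \<in> W a b" "b < a + m"
  shows "g * g = 1"
proof -
  have "b < a + n" using assms m_le by simp
  with assms(1) show ?thesis
  proof (induction rule: W_induct)
    case (mult i h)
    have "x i * h = h * x i"
      using mult assms m_le by (intro commute_near[OF mult(3)]) auto
    then show ?case using mult by (metis mult.assoc x_cancel)
  qed simp
qed

text \<open>The correction factor of \<open>refl_shift\<close> does no harm as long as it commutes with \<open>x (1 - i)\<close>.\<close>

lemma refl_x: "0 \<le> i \<Longrightarrow> i \<le> m \<Longrightarrow> \<rho> * x i * inverse \<rho> = x (1 - i)"
proof (induction i rule: int_ge_induct)
  case (step i)
  show ?case
  proof (cases "i = 0")
    case False
    define e where "e = t * \<rho> * t * inverse \<rho>"
    have \<rho>t: "\<rho> * t = inverse t * e * \<rho>" by (simp add: e_def mult.assoc)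
    have IH: "\<rho> * x i * inverse \<rho> = x (1 - i)" using step by simp
    have tx: "inverse t * x j * t = x (j - 1)" for j
    proof -
      have "x j = t * x (j - 1) * inverse t" using x_shift[of "j - 1"] by simp
      then show ?thesis by (simp add: mult.assoc)
    qed
    have "e * x (1 - i) = x (1 - i) * e"
      using refl_shift x_commute[of 1 "1 - i"] step False by (auto simp: e_def)
    then have exe: "e * x (1 - i) * inverse e = x (1 - i)"
      by (subst perm_conj_eq_iff)
    have "\<rho> * x (i + 1) * inverse \<rho> = (\<rho> * t) * x i * inverse (\<rho> * t)"
      by (simp add: x_shift[symmetric] mult.assoc)
    also have "\<dots> = inverse t * (e * (\<rho> * x i * inverse \<rho>) * inverse e) * t"
      unfolding \<rho>t by (simp add: mult.assoc)
    also have "\<dots> = x (1 - (i + 1))"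
      by (simp only: IH exe tx) (simp add: algebra_simps)
    finally show ?thesis .
  qed (simp add: refl_1)
qed (simp add: refl_0)

text \<open>The indices are confined to the range from 0 to \<open>m\<close> because
  \<open>refl_x\<close> describes the action of \<open>\<rho>\<close> only there.\<close>

lemma refl_W:
  assumes "g \<in> W a b" "0 \<le> a" "b \<le> m" "b < a + n"
  shows "\<rho> * g * inverse \<rho> \<in> W (1 - b) (1 - a)"
  using assms(1,4)
proof (induction rule: W_induct)
  case one
  show ?case by (simp add: W_one)
next
  case (mult i h)
  have "\<rho> * (x i * h) * inverse \<rho> = (\<rho> * x i * inverse \<rho>) * (\<rho> * h * inverse \<rho>)"
    by (simp add: mult.assoc)
  also have "\<dots> = x (1 - i) * (\<rho> * h * inverse \<rho>)"
    using refl_x mult assms by simp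
  also have "\<dots> \<in> W (1 - b) (1 - a)"
    by (rule W_mult[OF x_in mult(4)]) (use mult in auto)
  finally show ?case .
qed

text \<open>The reflection \<open>i \<mapsto> m - i\<close> of the indices, a translate of the
  reflection \<open>i \<mapsto> 1 - i\<close> given by \<open>\<rho>\<close>. It exchanges
  \<open>x 0\<close> and \<open>x m\<close>, the two entries of the commutator
  \<open>w\<close>.\<close>

definition \<sigma> where "\<sigma> = t ^ nat (m - 1) * \<rho>"

lemma \<sigma>_x:
  assumes "0 \<le> i" "i \<le> m"
  shows "\<sigma> * x i * inverse \<sigma> = x (m - i)"
proof -
  have "\<sigma> * x i * inverse \<sigma> = t ^ nat (m - 1) * (\<rho> * x i * inverse \<rho>) * inverse (t ^ nat (m - 1))"
    by (simp add: \<sigma>_def mult.assoc)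
  then show ?thesis using assms m_pos by (simp add: refl_x shift_power)
qed

lemma \<sigma>_W:
  assumes "g \<in> W a b" "0 \<le> a" "b \<le> m" "b < a + n"
  shows "\<sigma> * g * inverse \<sigma> \<in> W (m - b) (m - a)"
proof -
  have "\<sigma> * g * inverse \<sigma> = t ^ nat (m - 1) * (\<rho> * g * inverse \<rho>) * inverse (t ^ nat (m - 1))"
    by (simp add: \<sigma>_def mult.assoc)
  then show ?thesis
    using m_pos W_shift_power[of "nat (m - 1)" "\<rho> * g * inverse \<rho>" "1 - b" "1 - a"]
      refl_W[OF assms] by simp
qed

section \<open>The first nontrivial commutator\<close>

definition w where "w = x 0 * x m * x 0 * x m"

lemma x_0_x_m: "x 0 * x m * x 0 = w * x m"
  by (simp add: w_def mult.assoc)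

context
  assumes m_less: "m < n"
begin

lemma w_neq_1: "w \<noteq> 1"
  using noncommute[OF m_less] x_0_x_m by (metis mult.assoc mult.left_neutral x_cancel)

lemma w_mem: "w \<in> W 1 (m - 1)"
  using W_commutator[of "x 0" 0 m "x m"] m_pos m_less by (simp add: w_def x_in)

lemma two_le_m: "2 \<le> m"
  using w_mem w_neq_1 W_trivial[of w 1 "m - 1"] by linarith

lemma w_square: "w * w = 1"
  using W_elementary[OF w_mem] by simp

lemma w_inverse: "inverse w = w"
  by (rule perm.inverse_unique) (rule w_square)

text \<open>Exchanging its two entries inverts a commutator, and \<open>w\<close> is its own
  inverse. So an index range containing \<open>w\<close> may be reflected.\<close>

lemma \<sigma>_w: "\<sigma> * w * inverse \<sigma> = w"
proof -
  have "\<sigma> * w * inverse \<sigma> = (\<sigma> * x 0 * inverse \<sigma>) * (\<sigma> * x m * inverse \<sigma>) *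
      (\<sigma> * x 0 * inverse \<sigma>) * (\<sigma> * x m * inverse \<sigma>)"
    by (simp add: w_def mult.assoc)
  also have "\<dots> = x m * x 0 * x m * x 0"
    using m_pos by (simp add: \<sigma>_x)
  also have "\<dots> = inverse w" by (simp add: w_def mult.assoc)
  finally show ?thesis by (simp add: w_inverse)
qed

lemma w_reflect:
  assumes "w \<in> W a b" "0 \<le> a" "b \<le> m" "b < a + n"
  shows "w \<in> W (m - b) (m - a)"
  using \<sigma>_W[OF assms] by (simp add: \<sigma>_w)

text \<open>\<open>x 0\<close> centralises \<open>W 1 (m - 1)\<close>; the other elements of
  \<open>W 1 m\<close> have a factor \<open>x m\<close>, which contributes the commutator
  \<open>w\<close>. Conjugation by \<open>x 0\<close> is thus a test for the factor
  \<open>x m\<close>.\<close>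

lemma x_0_conj:
  assumes "g \<in> W 1 m"
  shows "g \<in> W 1 (m - 1) \<and> x 0 * g * x 0 = g \<or> g \<notin> W 1 (m - 1) \<and> x 0 * g * x 0 = w * g"
proof (cases "g \<in> W 1 (m - 1)")
  case True
  then show ?thesis
    using commute_near[OF True, of 0] m_pos m_le by (simp add: mult.assoc)
next
  case False
  then have h: "x m * g \<in> W 1 (m - 1)"
    using W_left[OF assms] m_less m_pos by auto
  have "x 0 * g * x 0 = x 0 * x m * (x m * g) * x 0"
    by (simp add: mult.assoc)
  also have "\<dots> = x 0 * x m * x 0 * (x m * g)"
    using commute_near[OF h, of 0] m_pos m_less by (simp add: mult.assoc)
  also have "\<dots> = w * g"
    unfolding x_0_x_m by (simp add: mult.assoc)
  finally show ?thesis using False by simp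
qed

text \<open>
  If \<open>m + r < n\<close>, then conjugation by \<open>x 0 * x (m + r)\<close> permutes \<open>w\<close>, \<open>u\<close> and \<open>w * u\<close> cyclically,
  although the order of this element is a power of 2.
\<close>

lemma obtain_r:
  obtains r where "1 \<le> r" "r < m" "w \<in> W r (m - 1)" "w \<notin> W (r + 1) (m - 1)" "n \<le> m + r"
proof -
  have "w \<notin> W m (m - 1)" using W_trivial w_neq_1 by force
  then obtain r where r: "1 \<le> r" "r < m" "w \<in> W r (m - 1)" "w \<notin> W (r + 1) (m - 1)"
    using obtain_last_int[of "\<lambda>r. w \<in> W r (m - 1)" 1 m] w_mem m_pos by auto
  have "n \<le> m + r"
  proof (rule ccontr)
    assume "\<not> n \<le> m + r"
    then have less: "m + r < n" by simp
    define y where "y = x (m + r)"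
    define u where "u = x r * y * x r * y"
    have y2: "y * y = 1" "y * (y * g) = g" "inverse y = y" for g by (simp_all add: y_def)
    have u_shift: "u = t ^ nat r * w * inverse (t ^ nat r)"
    proof -
      have "u = (t ^ nat r * x 0 * inverse (t ^ nat r)) * (t ^ nat r * x m * inverse (t ^ nat r)) *
          (t ^ nat r * x 0 * inverse (t ^ nat r)) * (t ^ nat r * x m * inverse (t ^ nat r))"
        unfolding shift_power using r by (simp add: u_def y_def)
      then show ?thesis by (simp add: w_def mult.assoc)
    qed
    have u_mem: "u \<in> W (1 + r) (m + r - 1)"
      using W_shift_power[of "nat r" w 1 "m - 1"] w_mem r by (simp add: u_shift algebra_simps)
    \<comment> \<open>Reflection turns the lowest index \<open>r\<close> of \<open>w\<close> into
      its highest index \<open>m - r\<close>. Hence the translate \<open>u\<close> reaches exactly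
      up to \<open>m\<close>, and conjugation by \<open>x 0\<close> multiplies it by
      \<open>w\<close>.\<close>
    have "w \<in> W 1 (m - r)" using w_reflect[OF r(3)] r m_less by simp
    then have u_mem': "u \<in> W (1 + r) m"
      using W_shift_power[of "nat r" w 1 "m - r"] r by (simp add: u_shift)
    have u_notin: "u \<notin> W (1 + r) (m - 1)"
    proof
      assume "u \<in> W (1 + r) (m - 1)"
      then have "w \<in> W 1 (m - 1 - r)"
        using W_shift_power[of "nat r" w 1 "m - 1 - r"] r by (simp add: u_shift)
      then show False using w_reflect[of 1 "m - 1 - r"] r m_less by (simp add: algebra_simps)
    qed
    have "x 0 * u * x 0 = w * u"
    proof -
      have "u \<in> W 1 m" using u_mem' W_mono[of 1 "1 + r" m m] r by auto
      moreover have "u \<notin> W 1 (m - 1)"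
        using W_Int[of u 1 "m - 1" "1 + r" m] u_mem' u_notin r m_less by auto
      ultimately show ?thesis using x_0_conj by blast
    qed
    moreover have "x 0 * w * x 0 = w" using x_0_conj[of w] w_mem W_mono[of 1 1 "m - 1" m] by auto
    moreover have "y * u * y = u"
      using commute_near[OF u_mem, of "m + r"] r m_less by (simp add: y2 mult.assoc flip: y_def)
    moreover have "y * w * y = u * w"
    proof -
      \<comment> \<open>Once \<open>x r\<close> is split off, the rest of \<open>w\<close> has
        indices above \<open>r\<close> and commutes with \<open>y\<close>; only the commutator
        \<open>u\<close> of \<open>x r\<close> and \<open>y\<close> remains.\<close>
      have h: "x r * w \<in> W (r + 1) (m - 1)"
        using W_right[OF r(3)] r m_less by auto
      have "y * w * y = y * x r * (x r * w) * y" by (simp add: mult.assoc)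
      also have "\<dots> = y * x r * y * (x r * w)"
        using commute_near[OF h, of "m + r"] r m_less by (simp add: mult.assoc flip: y_def)
      also have "y * x r * y = x r * u" by (simp add: u_def mult.assoc)
      also have "x r * u = u * x r"
        using commute_near[OF u_mem, of r] r m_less by simp
      finally show ?thesis by (simp add: mult.assoc)
    qed
    moreover have wu: "w * u = u * w"
    proof (rule W_abelian[of _ 1 m])
      show "w \<in> W 1 m" using w_mem W_mono[of 1 1 "m - 1" m] by auto
      show "u \<in> W 1 m" using u_mem' W_mono[of 1 "1 + r" m m] r by auto
    qed simp
    moreover have u2: "u * u = 1"
      using W_elementary[OF u_mem] by simp
    moreover define z where "z = x 0 * y"
    moreover have iz: "inverse z = y * x 0" by (simp add: z_def y2)
    ultimately have iz: "inverse z = y * x 0" and z: "z = x 0 * y"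
      and xux: "x 0 * u * x 0 = w * u" and xwx: "x 0 * w * x 0 = w" and yuy: "y * u * y = u"
      and ywy: "y * w * y = u * w" and wu: "w * u = u * w" and u2: "u * u = 1"
      by blast+
    have "z * w * inverse z = x 0 * (y * w * y) * x 0" unfolding iz unfolding z by (simp add: mult.assoc)
    also have "\<dots> = (x 0 * u * x 0) * (x 0 * w * x 0)" unfolding ywy by (simp add: mult.assoc)
    also have "\<dots> = (w * u) * w" by (simp only: xux xwx)
    also have "\<dots> = u * (w * w)" by (simp only: wu mult.assoc)
    finally have fw: "z * w * inverse z = u" by (simp add: w_square)
    have "z * u * inverse z = x 0 * (y * u * y) * x 0" unfolding iz unfolding z by (simp add: mult.assoc)
    then have fu: "z * u * inverse z = w * u" by (simp only: yuy xux)
    have fwu: "z * (w * u) * inverse z = w"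
    proof -
      have "z * (w * u) * inverse z = (z * w * inverse z) * (z * u * inverse z)"
        by (simp add: mult.assoc)
      then show ?thesis by (metis fw fu wu u2 mult.assoc mult.right_neutral)
    qed
    have z3: "z ^ (3 * q) * w * inverse (z ^ (3 * q)) = w" for q
    proof (induction q)
      case (Suc q)
      have *: "z ^ (3 * Suc q) = z * (z * (z * z ^ (3 * q)))"
        by (simp add: numeral_3_eq_3 power_add mult.assoc)
      have "z ^ (3 * Suc q) * w * inverse (z ^ (3 * Suc q)) =
          z * (z * (z * (z ^ (3 * q) * w * inverse (z ^ (3 * q))) * inverse z) * inverse z) * inverse z"
        unfolding * by (simp add: mult.assoc)
      then show ?case unfolding Suc fw fu fwu .
    qed simp
    have "z \<in> W 0 (m + r)"
      unfolding z_def y_def using r by (intro W_mult x_in) auto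
    then obtain k where k: "z ^ (2 ^ k) = 1" using W_power_of_2 less by fastforce
    \<comment> \<open>A power of 2 is 1 or 2 modulo 3, while \<open>z ^ 3\<close> centralises
      \<open>w\<close>; so \<open>z ^ (2 ^ k) = 1\<close> forces \<open>w = u\<close> or
      \<open>w = w * u\<close>.\<close>
    have *: "\<exists>q. N = Suc (3 * q) \<or> N = Suc (Suc (3 * q))" if "N mod 3 = 1 \<or> N mod 3 = 2" for N :: nat
      using that by presburger
    have "(2 ^ k) mod 3 = (1::nat) \<or> (2 ^ k) mod 3 = (2::nat)"
      by (induction k) (simp_all, presburger)
    then obtain q where "2 ^ k = Suc (3 * q) \<or> 2 ^ k = Suc (Suc (3 * q))"
      using * by blast
    then show False
    proof
      assume "2 ^ k = Suc (3 * q)"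
      then have "z * z ^ (3 * q) = 1" using k by simp
      then have "w = (z * z ^ (3 * q)) * w * inverse (z * z ^ (3 * q))" by simp
      also have "\<dots> = z * (z ^ (3 * q) * w * inverse (z ^ (3 * q))) * inverse z"
        by (simp add: mult.assoc)
      also have "\<dots> = u" by (simp only: z3 fw)
      finally have "w = u" .
      then show False using fw fu u2 w_neq_1 by metis
    next
      assume "2 ^ k = Suc (Suc (3 * q))"
      then have "z * (z * z ^ (3 * q)) = 1" using k by simp
      then have "w = (z * (z * z ^ (3 * q))) * w * inverse (z * (z * z ^ (3 * q)))" by simp
      also have "\<dots> = z * (z * (z ^ (3 * q) * w * inverse (z ^ (3 * q))) * inverse z) * inverse z"
        by (simp add: mult.assoc)
      also have "\<dots> = w * u" by (simp only: z3 fw fu)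
      finally have "w = w * u" .
      then show False using fu fwu w_neq_1 fw
        by (metis mult.right_neutral perm.left_cancel perm.right_inverse)
    qed
  qed
  with r that show thesis by blast
qed

text \<open>
  Let \<open>c = [x 0, x q]\<close>, with highest factor \<open>x (m + k)\<close> say. If \<open>k > 0\<close>, conjugating \<open>c\<close> by \<open>x k\<close>
  multiplies it by a translate of \<open>w\<close>; computed from the definition of \<open>c\<close> and the induction
  hypothesis for \<open>[x k, x q]\<close>, the same factor is 1 or \<open>w\<close> itself, which is impossible.
\<close>

lemma commutator_mem:
  assumes "0 \<le> j" "j < q" "q < n"
  shows "x j * x q * x j * x q \<in> W 0 (m - 1)"
  using assms
proof (induction "nat q" arbitrary: j q rule: less_induct)
  case less
  obtain r where r: "1 \<le> r" "r < m" "w \<in> W r (m - 1)" "w \<notin> W (r + 1) (m - 1)" "n \<le> m + r"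
    by (rule obtain_r)
  have triv: "x j * x q * x j * x q \<in> W 0 (m - 1)" if "q - j < m"
  proof -
    have "x j * x q = x q * x j" using that less.prems by (intro x_commute) simp
    then show ?thesis by (simp add: mult.assoc W_one)
  qed
  show ?case
  proof (cases "q - j < m")
    case False
    define y where "y = x q"
    define c where "c = x 0 * y * x 0 * y"
    define d where "d i = x i * y * x i * y" for i
    have y2: "y * y = 1" "y * (y * g) = g" "inverse y = y" for g by (simp_all add: y_def)
    \<comment> \<open>\<open>d i\<close> is the translate of a commutator with smaller
      \<open>q\<close>, whence the upper bound \<open>m\<close>; the general commutator rule
      supplies the lower bound \<open>i + 1\<close>.\<close>
    have d_mem: "d i \<in> W (i + 1) m" if i: "1 \<le> i" "i < q" for i
    proof -
      have "x (i - 1) * x (q - 1) * x (i - 1) * x (q - 1) \<in> W 0 (m - 1)"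
        using i less.prems by (intro less.hyps) auto
      then have 1: "d i \<in> W 1 m"
        using commutator_shift by (force simp: d_def y_def)
      have 2: "d i \<in> W (i + 1) (q - 1)"
        using W_commutator[of "x i" i q y] i less.prems by (simp add: d_def y_def x_in)
      show ?thesis
      proof (cases "m \<le> q - 1")
        case True
        then show ?thesis using W_Int[OF 1 2] i less.prems by simp
      next
        case False
        then show ?thesis using 2 W_mono[of "i + 1" "i + 1" "q - 1" m] by auto
      qed
    qed
    have d_mem_1: "d i \<in> W 1 m" if "1 \<le> i" "i < q" for i
      using d_mem[OF that] W_mono[of 1 "i + 1" m m] that by auto
    have c_mem: "c \<in> W 1 (q - 1)"
      using W_commutator[of "x 0" 0 q y] less.prems by (simp add: c_def y_def x_in)
    \<comment> \<open>Conjugation by \<open>x i\<close> fixes \<open>x 0\<close> and turns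
      \<open>y\<close> into \<open>d i * y = y * inverse (d i)\<close>.\<close>
    have key: "x i * c * x i = (x 0 * d i * x 0) * c * inverse (d i)" if "1 \<le> i" "i < m" for i
    proof -
      have comm: "x i * x 0 = x 0 * x i" using that by (intro x_commute) simp
      have "x i * c * x i = (x i * x 0) * y * x 0 * y * x i" by (simp add: c_def mult.assoc)
      also have "\<dots> = (x 0 * x i) * y * x 0 * y * x i" by (simp only: comm)
      also have "\<dots> = x 0 * (x i * y * x i) * (x i * x 0) * y * x i"
        by (simp add: mult.assoc)
      also have "\<dots> = x 0 * (x i * y * x i) * (x 0 * x i) * y * x i" by (simp only: comm)
      also have "\<dots> = (x 0 * d i * x 0) * c * inverse (d i)"
        by (simp add: d_def c_def y2 mult.assoc)
      finally show ?thesis .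
    qed
    have c_mem': "c \<in> W 1 (m - 1)"
    proof (rule ccontr)
      assume notin: "c \<notin> W 1 (m - 1)"
      obtain k where k: "0 \<le> k" "m + k < q" "c \<in> W 1 (m + k)" "c \<notin> W 1 (m + k - 1)"
      proof -
        obtain p where "m - 1 \<le> p" "p < q - 1" "c \<notin> W 1 p" "c \<in> W 1 (p + 1)"
          by (rule obtain_last_int[of "\<lambda>p. c \<notin> W 1 p" "m - 1" "q - 1"])
            (use notin c_mem less.prems False in auto)
        then show thesis using that[of "p + 1 - m"] by simp
      qed
      show False
      proof (cases "k = 0")
        case True
        \<comment> \<open>With top index \<open>m\<close> the element \<open>c\<close> is its own
          inverse, so \<open>x 0\<close>, which inverts it, fixes it; but the factor
          \<open>x m\<close> would add a \<open>w\<close>.\<close>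
        have "c * c = 1" using W_elementary[OF k(3)] True by simp
        moreover have "x 0 * c * x 0 = inverse c" by (simp add: c_def y2 mult.assoc)
        ultimately have "x 0 * c * x 0 = c" by (simp add: perm.inverse_unique)
        moreover have "x 0 * c * x 0 = w * c"
          using x_0_conj[of c] k True by simp
        ultimately show False using w_neq_1 perm.right_cancel[of w c 1] by simp
      next
        case False
        define v where "v = t ^ nat k * w * inverse (t ^ nat k)"
        have km: "1 \<le> k" "k < m" using False k less.prems r by auto
        have v: "v = x k * x (m + k) * x k * x (m + k)"
        proof -
          have "v = (t ^ nat k * x 0 * inverse (t ^ nat k)) * (t ^ nat k * x m * inverse (t ^ nat k)) *
              (t ^ nat k * x 0 * inverse (t ^ nat k)) * (t ^ nat k * x m * inverse (t ^ nat k))"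
            by (simp add: w_def v_def mult.assoc)
          then show ?thesis unfolding shift_power using km by simp
        qed
        have h: "x (m + k) * c \<in> W 1 (m + k - 1)"
          using W_left[OF k(3)] k less.prems m_pos by auto
        have "x k * c * x k = x k * x (m + k) * (x (m + k) * c) * x k"
          by (simp add: mult.assoc)
        also have "\<dots> = x k * x (m + k) * x k * (x (m + k) * c)"
          using commute_near[OF h, of k] km k less.prems by (simp add: mult.assoc)
        also have "\<dots> = v * c" by (simp add: v mult.assoc)
        finally have vc: "v * c = (x 0 * d k * x 0) * c * inverse (d k)"
          using key[of k] km by simp
        have dc: "d k * c = c * d k"
          using W_commute[OF d_mem[of k] k(3)] km k less.prems m_less by simp
        have "x 0 * d k * x 0 = d k \<or> x 0 * d k * x 0 = w * d k"
          using x_0_conj[OF d_mem_1[of k]] km k by auto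
        then have "v * c = c \<or> v * c = w * c"
        proof
          assume "x 0 * d k * x 0 = d k"
          then have "v * c = (d k * c) * inverse (d k)" unfolding vc by simp
          then show ?thesis by (simp add: dc mult.assoc)
        next
          assume "x 0 * d k * x 0 = w * d k"
          then have "v * c = w * (d k * c) * inverse (d k)" unfolding vc by (simp add: mult.assoc)
          then show ?thesis by (simp add: dc mult.assoc)
        qed
        then have "v = 1 \<or> v = w"
          using perm.right_cancel[of v c 1] perm.right_cancel[of v c w] by auto
        then show False
        proof
          assume "v = 1"
          then have "t ^ nat k * w = t ^ nat k" by (simp add: v_def perm_conj_eq_iff)
          then show False using w_neq_1 perm.left_cancel[of "t ^ nat k" w 1] by simp
        next
          assume "v = w"
          \<comment> \<open>\<open>w\<close> now also lies in its own range moved up by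
            \<open>k\<close>. Intersecting this with \<open>W 1 (m - 1)\<close> gives a range
            starting above \<open>r\<close>, against the choice of \<open>r\<close>.\<close>
          then have "w \<in> W (r + k) (m - 1 + k)"
            using W_shift_power[of "nat k" w r "m - 1"] r km by (simp add: v_def)
          then have "w \<in> W (r + k) (m - 1)"
            using W_Int[OF w_mem] r k km less.prems by simp
          then show False
            using r km W_mono[of "r + 1" "r + k" "m - 1" "m - 1"] by auto
        qed
      qed
    qed
    show ?thesis
    proof (cases "j = 0")
      case True
      then show ?thesis using c_mem' W_mono[of 0 1 "m - 1" "m - 1"] by (auto simp: c_def y_def)
    next
      case False
      have jm: "1 \<le> j" "j < m" using False less.prems r \<open>\<not> q - j < m\<close> by auto
      \<comment> \<open>Now \<open>key\<close> gives information on \<open>d j\<close>: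
        \<open>c\<close> is known to commute with \<open>x j\<close>, so a factor \<open>x m\<close>
        in \<open>d j\<close> would yield \<open>c = w * c\<close>.\<close>
      have "d j \<in> W 1 (m - 1)"
      proof (rule ccontr)
        assume "d j \<notin> W 1 (m - 1)"
        then have "x 0 * d j * x 0 = w * d j"
          using x_0_conj[OF d_mem_1[of j]] jm less.prems by auto
        moreover have "d j * c = c * d j"
          using W_commute[OF d_mem[of j] c_mem'] jm less.prems m_less by simp
        moreover have "x j * c * x j = c"
          using commute_near[OF c_mem', of j] jm m_less by (simp add: mult.assoc)
        ultimately have "c = w * c" using key[of j] jm by (simp add: mult.assoc)
        then show False using w_neq_1 perm.right_cancel[of w c 1] by simp
      qed
      then show ?thesis using W_mono[of 0 1 "m - 1" "m - 1"] by (auto simp: d_def y_def)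
    qed
  qed (rule triv)
qed

end

section \<open>Exponents of the groups in the chain\<close>

lemma factorization:
  assumes "g \<in> W 0 q" "m - 1 \<le> q" "q < n"
  shows "\<exists>b \<in> W m q. \<exists>a \<in> W 0 (m - 1). g = b * a"
  using assms(2,1,3)
proof (induction q arbitrary: g rule: int_ge_induct)
  case base
  then show ?case by (intro bexI[of _ 1] bexI[of _ g]) (simp_all add: W_one)
next
  case (step q)
  have *: "\<exists>b \<in> W m (q + 1). \<exists>a \<in> W 0 (m - 1). h = b * a" if "h \<in> W 0 q" for h
    using step.IH[OF that] step.prems W_mono[of m m q "q + 1"] by auto
  have "g \<in> W 0 q \<or> x (q + 1) * g \<in> W 0 q"
    using W_left[OF step.prems(1)] step m_pos by simp
  then show ?case
  proof
    assume "x (q + 1) * g \<in> W 0 q"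
    then obtain a b where ab: "b \<in> W m (q + 1)" "a \<in> W 0 (m - 1)" "x (q + 1) * g = b * a"
      using * by blast
    then have "x (q + 1) * b \<in> W m (q + 1)"
      using step by (intro W_mult x_in) auto
    moreover have "g = (x (q + 1) * b) * a"
      using ab(3) by (metis mult.assoc x_cancel)
    ultimately show ?thesis using ab(2) by blast
  qed (rule *)
qed

lemma exponent_4:
  assumes "g \<in> W 0 (n - 1)"
  shows "g ^ 4 = 1"
proof -
  \<comment> \<open>Conjugation by \<open>x q\<close> changes a factor \<open>x i\<close> by the
    commutator of the two, which lies in the same group by \<open>commutator_mem\<close>.\<close>
  have A_normal: "x q * a * x q \<in> W 0 (m - 1)" if q: "m \<le> q" "q \<le> n - 1" and a: "a \<in> W 0 (m - 1)" for q a
  proof -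
    have m_less: "m < n" using q by simp
    have "m - 1 < 0 + n" using m_le by simp
    with a show ?thesis
    proof (induction rule: W_induct)
      case (mult i h)
      have "x i * x q * x i * x q \<in> W 0 (m - 1)"
        using mult q by (intro commutator_mem m_less) auto
      then have "x i * (x i * x q * x i * x q) * (x q * h * x q) \<in> W 0 (m - 1)"
        using mult x_in[of 0 i "m - 1"] W_mult by simp
      then show ?case by (simp add: mult.assoc)
    qed (simp add: W_one)
  qed
  obtain a b where ab: "b \<in> W m (n - 1)" "a \<in> W 0 (m - 1)" "g = b * a"
    using factorization[OF assms] m_le by force
  \<comment> \<open>For \<open>m < n\<close> this comes from \<open>n \<le> m + r\<close> and
    \<open>r < m\<close>. It makes the indices \<open>m\<close>, ..., \<open>n - 1\<close> differ by
    less than \<open>m\<close>.\<close>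
  have "n \<le> 2 * m"
  proof (cases "m < n")
    case True
    then show ?thesis using obtain_r by fastforce
  qed (use m_pos in simp)
  then have b2: "b * b = 1" using W_elementary[OF ab(1)] by simp
  have "n - 1 < m + n" using m_pos by simp
  with ab(1) have bab: "b * a * inverse b \<in> W 0 (m - 1)"
  proof (induction rule: W_induct)
    case (mult i h)
    have "x i * (h * a * inverse h) * x i \<in> W 0 (m - 1)"
      using mult by (intro A_normal) auto
    then show ?case by (simp add: mult.assoc)
  qed (simp add: ab)
  have "g * g = (b * a * inverse b) * (b * b) * a" by (simp add: ab mult.assoc)
  then have "g * g \<in> W 0 (m - 1)" using bab b2 ab by (simp add: W_mult)
  then have "(g * g) * (g * g) = 1" by (rule W_elementary) simp
  then show ?thesis by (simp add: numeral_eq_Suc mult.assoc)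
qed

text \<open>The displayed product is the commutator of \<open>x 0 * x n\<close> with
  \<open>x 1\<close>. For \<open>n \<le> m + 1\<close> the indices from 1 to \<open>n - 1\<close>
  are close enough to commute. Otherwise the commutator of \<open>x 1\<close> and \<open>x n\<close>
  lies in \<open>W 2 m\<close>, as does \<open>w\<close>, so conjugation by \<open>x 0\<close> does
  not leave \<open>W 2 m\<close>. The second alternative is kept open here and refuted for arcs in
  \<open>arc_kernel\<close>.\<close>

lemma kernel_alternative:
  "(\<forall>g \<in> W 1 (n - 1). g * g = 1) \<or>
    2 < n \<and> x 0 * x n * x 1 * x n * x 0 * x 1 \<in> W 2 (n - 2)"
proof (cases "n \<le> m + 1")
  case True
  then show ?thesis using W_elementary[of _ 1 "n - 1"] by simp
next
  case False
  then have m_less: "m < n" by simp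
  obtain r where r: "1 \<le> r" "r < m" "w \<in> W r (m - 1)" "w \<notin> W (r + 1) (m - 1)" "n \<le> m + r"
    by (rule obtain_r[OF m_less])
  \<comment> \<open>Here \<open>m + 1 < n\<close> and \<open>n \<le> m + r\<close> give
    \<open>2 \<le> r\<close>.\<close>
  have w: "w \<in> W 2 m" using r(3) W_mono[of 2 r "m - 1" m] False r by auto
  define c where "c = x 1 * x n * x 1 * x n"
  have "x 0 * x (n - 1) * x 0 * x (n - 1) \<in> W 0 (m - 1)"
    using m_less m_pos by (intro commutator_mem) auto
  moreover have "x 0 * x (n - 1) * x 0 * x (n - 1) \<in> W 1 (n - 2)"
    using W_commutator[of "x 0" 0 "n - 1" "x (n - 1)"] n_pos by (simp add: x_in)
  ultimately have "x 0 * x (n - 1) * x 0 * x (n - 1) \<in> W 1 (m - 1)"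
    using W_Int[of _ 0 "m - 1" 1 "n - 2"] False by simp
  then have c: "c \<in> W 2 m" using commutator_shift[of 0 "n - 1" 1 "m - 1"] by (simp add: c_def)
  then have "x 0 * c * x 0 = c \<or> x 0 * c * x 0 = w * c"
    using x_0_conj[OF m_less, of c] W_mono[of 1 2 m m] by auto
  then have xcx: "x 0 * c * x 0 \<in> W 2 m" using c w W_mult by auto
  have x01: "x 0 * x 1 = x 1 * x 0"
    using two_le_m[OF m_less] by (intro x_commute) simp
  have "x 0 * x n * x 1 * x n * x 0 * x 1 = x 0 * x 1 * c * x 0 * x 1"
    by (simp add: c_def mult.assoc)
  also have "\<dots> = x 1 * (x 0 * c * x 0) * x 1"
    by (simp add: x01 mult.assoc)
  also have "\<dots> = x 0 * c * x 0"
    using commute_near[OF xcx, of 1] m_less m_pos by (simp add: mult.assoc)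
  finally show ?thesis
    using xcx W_mono[of 2 2 m "n - 2"] False two_le_m[OF m_less] by auto
qed

end

lemma (in involution_chain) obtain_commuting_chain:
  obtains m where "commuting_chain n x W t \<rho> m"
proof (cases "\<forall>j. 0 \<le> j \<and> j < n \<longrightarrow> x 0 * x j = x j * x 0")
  case True
  then have "commuting_chain n x W t \<rho> n"
    using n_pos by unfold_locales auto
  then show thesis by (rule that)
next
  case False
  then obtain j where j: "0 \<le> j" "j < n" "x 0 * x j \<noteq> x j * x 0" by blast
  define P where "P = (\<lambda>k. \<forall>i. 0 \<le> i \<and> i < k \<longrightarrow> x 0 * x i = x i * x 0)"
  have "P 0" "\<not> P n" using j by (auto simp: P_def)
  then obtain m where m: "0 \<le> m" "m < n" "P m" "\<not> P (m + 1)"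
    using obtain_last_int[of P 0 n] n_pos by auto
  then have nc: "x 0 * x m \<noteq> x m * x 0"
    by (auto simp: P_def) (metis linorder_neqE_linordered_idom zle_add1_eq_le not_less)
  then have "m \<noteq> 0" by auto
  then have "commuting_chain n x W t \<rho> m"
    using m nc by unfold_locales (auto simp: P_def)
  then show thesis by (rule that)
qed

context involution_chain
begin

theorem chain_exponent_4: "g \<in> W 0 (n - 1) \<Longrightarrow> g ^ 4 = 1"
  using obtain_commuting_chain commuting_chain.exponent_4 by metis

theorem chain_kernel_alternative:
  "(\<forall>g \<in> W 1 (n - 1). g * g = 1) \<or>
    2 < n \<and> x 0 * x n * x 1 * x n * x 0 * x 1 \<in> W 2 (n - 2)"
  using obtain_commuting_chain commuting_chain.kernel_alternative by metis

end

section \<open>Arc-transitive digraphs of valency two\<close>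

text \<open>
  The reversal \<open>bar\<close> turns successors into predecessors. It need not be induced by \<open>G\<close>, and
  connectedness is meant up to reversal.
\<close>

locale dart_action =
  fixes G :: "'a perm set"
    and act :: "'a perm \<Rightarrow> 'd \<Rightarrow> 'd"
    and D :: "'d set"
    and succ :: "'d \<Rightarrow> 'd set"
    and bar :: "'d \<Rightarrow> 'd"
  assumes G_finite: "finite G"
    and G_one: "1 \<in> G"
    and G_mult: "g \<in> G \<Longrightarrow> h \<in> G \<Longrightarrow> g * h \<in> G"
    and G_inverse: "g \<in> G \<Longrightarrow> inverse g \<in> G"
    and act_one [simp]: "act 1 d = d"
    and act_mult [simp]: "act (g * h) d = act g (act h d)"
    and D_nonempty: "D \<noteq> {}"
    and act_D: "g \<in> G \<Longrightarrow> d \<in> D \<Longrightarrow> act g d \<in> D"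
    and bar_D: "d \<in> D \<Longrightarrow> bar d \<in> D"
    and bar_bar: "d \<in> D \<Longrightarrow> bar (bar d) = d"
    and act_bar: "g \<in> G \<Longrightarrow> d \<in> D \<Longrightarrow> act g (bar d) = bar (act g d)"
    and succ_D: "d \<in> D \<Longrightarrow> succ d \<subseteq> D"
    and card_succ: "d \<in> D \<Longrightarrow> card (succ d) = 2"
    and act_succ: "g \<in> G \<Longrightarrow> d \<in> D \<Longrightarrow> e \<in> succ d \<Longrightarrow> act g e \<in> succ (act g d)"
    and bar_succ: "d \<in> D \<Longrightarrow> e \<in> succ d \<Longrightarrow> bar d \<in> succ (bar e)"
    and transitive: "d \<in> D \<Longrightarrow> e \<in> D \<Longrightarrow> \<exists>g \<in> G. act g d = e"
    and moves_succ: "d \<in> D \<Longrightarrow> e \<in> succ d \<Longrightarrow> \<exists>g \<in> G. act g d = d \<and> act g e \<noteq> e"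
    and faithful: "g \<in> G \<Longrightarrow> (\<And>d. d \<in> D \<Longrightarrow> act g d = d) \<Longrightarrow> g = 1"
    and connected: "F \<subseteq> D \<Longrightarrow> F \<noteq> {} \<Longrightarrow> (\<And>d e. d \<in> F \<Longrightarrow> e \<in> succ d \<Longrightarrow> e \<in> F) \<Longrightarrow>
      (\<And>d. d \<in> F \<Longrightarrow> bar d \<in> F) \<Longrightarrow> F = D"
begin

lemma act_inverse [simp]: "act (inverse g) (act g d) = d" "act g (act (inverse g) d) = d"
  by (simp_all flip: act_mult)

lemma act_eq_iff: "act g d = e \<longleftrightarrow> d = act (inverse g) e"
  by auto

lemma succ_in_D: "d \<in> D \<Longrightarrow> e \<in> succ d \<Longrightarrow> e \<in> D"
  using succ_D by blast

lemma succ_eq: "d \<in> D \<Longrightarrow> e \<in> succ d \<Longrightarrow> f \<in> succ d \<Longrightarrow> e \<noteq> f \<Longrightarrow> succ d = {e, f}"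
  using card_succ[of d] by (auto simp: card_2_iff)

lemma succ_nonempty: "d \<in> D \<Longrightarrow> \<exists>e. e \<in> succ d"
  using card_succ[of d] by (auto simp: card_2_iff)

lemma edge_transitive:
  assumes "d \<in> D" "e \<in> succ d" "d' \<in> D" "e' \<in> succ d'"
  shows "\<exists>g \<in> G. act g d = d' \<and> act g e = e'"
proof -
  obtain g where g: "g \<in> G" "act g d = d'" using transitive assms by blast
  obtain h where h: "h \<in> G" "act h d = d" "act h e \<noteq> e" using moves_succ assms by blast
  have "act g e \<in> succ d'" "act g (act h e) \<in> succ d'"
    using g h assms act_succ[of g d e] act_succ[of "g * h" d e] G_mult by auto
  moreover have "act g (act h e) \<noteq> act g e" using h by (metis act_inverse(1))
  ultimately have "e' = act g e \<or> e' = act (g * h) e"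
    using succ_eq assms by force
  moreover have "act (g * h) d = d'" using g h by simp
  ultimately show ?thesis using g h G_mult by blast
qed

lemma act_bar_fixed: "g \<in> G \<Longrightarrow> d \<in> D \<Longrightarrow> act g (bar d) = bar d \<longleftrightarrow> act g d = d"
  by (metis act_bar act_D bar_bar)

text \<open>Two elements moving one of two successors both exchange them.\<close>

lemma two_succ:
  assumes d: "d \<in> D" and g: "g \<in> G" "act g d = d" and h: "h \<in> G" "act h d = d" and e: "e \<in> succ d"
  shows "act g (act g e) = e"
    and "act g (act h e) = act h (act g e)"
    and "act g e \<noteq> e \<Longrightarrow> act h e \<noteq> e \<Longrightarrow> act h (act g e) = e"
proof -
  obtain f where f: "succ d = {e, f}" "e \<noteq> f"
  proof -
    obtain p q where "succ d = {p, q}" "p \<noteq> q" using card_succ[OF d] by (auto simp: card_2_iff)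
    then show thesis using e that[of p] that[of q] by (auto simp: insert_commute)
  qed
  have *: "act k e = e \<and> act k f = f \<or> act k e = f \<and> act k f = e" if "k \<in> G" "act k d = d" for k
  proof -
    have "act k e \<in> {e, f}" "act k f \<in> {e, f}"
      using act_succ[OF that(1) d, of e] act_succ[OF that(1) d, of f] that f by auto
    moreover have "act k e \<noteq> act k f" using f by (metis act_inverse(1))
    ultimately show ?thesis by auto
  qed
  show "act g (act g e) = e" "act g (act h e) = act h (act g e)"
    "act g e \<noteq> e \<Longrightarrow> act h e \<noteq> e \<Longrightarrow> act h (act g e) = e"
    using *[OF g] *[OF h] by auto
qed

text \<open>\<open>bar\<close> commutes with the action and carries predecessors of \<open>d\<close>
  to successors of \<open>bar d\<close>, so this is \<open>two_succ\<close> at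
  \<open>bar d\<close>.\<close>

lemma two_pred:
  assumes e: "e \<in> D" and d: "d \<in> succ e" and g: "g \<in> G" "act g d = d" and h: "h \<in> G" "act h d = d"
  shows "act g (act g e) = e"
    and "act g (act h e) = act h (act g e)"
    and "act g e \<noteq> e \<Longrightarrow> act h e \<noteq> e \<Longrightarrow> act h (act g e) = e"
proof -
  have dD: "d \<in> D" using succ_in_D e d .
  have bar_inj: "bar p = bar q \<longleftrightarrow> p = q" if "p \<in> D" "q \<in> D" for p q
    using that by (metis bar_bar)
  have bar_fixed: "act g (bar d) = bar d" "act h (bar d) = bar d"
    using act_bar dD g h by simp_all
  note two = two_succ[OF bar_D[OF dD] g(1) bar_fixed(1) h(1) bar_fixed(2) bar_succ[OF e d]]
  show "act g (act g e) = e"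
    using two(1) by (simp add: act_bar e g act_D bar_inj)
  show "act g (act h e) = act h (act g e)"
    using two(2) by (simp add: act_bar e g h act_D bar_inj)
  show "act g e \<noteq> e \<Longrightarrow> act h e \<noteq> e \<Longrightarrow> act h (act g e) = e"
    using two(3) by (simp add: act_bar e g h act_D bar_inj)
qed

end

section \<open>Pointwise stabilisers along a line of darts\<close>

locale dart_line = dart_action +
  fixes t :: "'a perm" and \<omega> :: "int \<Rightarrow> 'b"
  assumes t: "t \<in> G"
    and \<omega>_D: "\<omega> i \<in> D"
    and \<omega>_succ: "\<omega> (i + 1) \<in> succ (\<omega> i)"
    and act_t: "act t (\<omega> i) = \<omega> (i + 1)"
begin

definition Fix :: "int \<Rightarrow> int \<Rightarrow> 'a perm set" where
  "Fix a b = {g \<in> G. \<forall>i. a \<le> i \<and> i \<le> b \<longrightarrow> act g (\<omega> i) = \<omega> i}"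

lemma FixI: "g \<in> G \<Longrightarrow> (\<And>i. a \<le> i \<Longrightarrow> i \<le> b \<Longrightarrow> act g (\<omega> i) = \<omega> i) \<Longrightarrow> g \<in> Fix a b"
  by (simp add: Fix_def)

lemma Fix_G: "g \<in> Fix a b \<Longrightarrow> g \<in> G"
  by (simp add: Fix_def)

lemma FixD: "g \<in> Fix a b \<Longrightarrow> a \<le> i \<Longrightarrow> i \<le> b \<Longrightarrow> act g (\<omega> i) = \<omega> i"
  by (simp add: Fix_def)

lemma Fix_one: "1 \<in> Fix a b"
  by (simp add: Fix_def G_one)

lemma Fix_mult: "g \<in> Fix a b \<Longrightarrow> h \<in> Fix a b \<Longrightarrow> g * h \<in> Fix a b"
  by (simp add: Fix_def G_mult)

lemma Fix_mono: "a \<le> a' \<Longrightarrow> b' \<le> b \<Longrightarrow> Fix a b \<subseteq> Fix a' b'"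
  by (auto simp: Fix_def)

lemma finite_Fix: "finite (Fix a b)"
  using G_finite by (rule finite_subset[rotated]) (auto simp: Fix_def)

lemma act_t_inverse: "act (inverse t) (\<omega> i) = \<omega> (i - 1)"
  using act_t[of "i - 1"] by (simp add: act_eq_iff[symmetric] eq_commute)

lemma Fix_shift: "t * g * inverse t \<in> Fix (a + 1) (b + 1) \<longleftrightarrow> g \<in> Fix a b"
proof
  assume g: "g \<in> Fix a b"
  show "t * g * inverse t \<in> Fix (a + 1) (b + 1)"
  proof (rule FixI)
    show "t * g * inverse t \<in> G" using g t by (simp add: Fix_G G_mult G_inverse)
    show "act (t * g * inverse t) (\<omega> i) = \<omega> i" if "a + 1 \<le> i" "i \<le> b + 1" for i
      using FixD[OF g, of "i - 1"] that by (simp add: act_t_inverse act_t)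
  qed
next
  assume g: "t * g * inverse t \<in> Fix (a + 1) (b + 1)"
  show "g \<in> Fix a b"
  proof (rule FixI)
    have "inverse t * (t * g * inverse t) * t \<in> G"
      by (rule G_mult[OF G_mult[OF G_inverse[OF t] Fix_G[OF g]] t])
    then show "g \<in> G" by (simp add: mult.assoc)
    show "act g (\<omega> i) = \<omega> i" if "a \<le> i" "i \<le> b" for i
    proof -
      have "act t (act g (\<omega> i)) = \<omega> (i + 1)"
        using FixD[OF g, of "i + 1"] that by (simp add: act_t_inverse)
      then show ?thesis by (simp add: act_eq_iff act_t_inverse)
    qed
  qed
qed

lemma Fix_shift_back: "inverse t * g * t \<in> Fix a b \<longleftrightarrow> g \<in> Fix (a + 1) (b + 1)"
  using Fix_shift[of "inverse t * g * t" a b] by (simp add: mult.assoc)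

text \<open>\<open>G\<close> will turn out to act regularly on the paths with \<open>n + 1\<close> darts.\<close>

definition n :: nat where
  "n = (LEAST k. Fix 0 (int k) \<subseteq> Fix 0 (int k + 1))"

lemma n_exists: "\<exists>k. Fix 0 (int k) \<subseteq> Fix 0 (int k + 1)"
proof (rule ccontr)
  assume *: "\<not> ?thesis"
  have "card (Fix 0 (int k)) + k \<le> card G" for k
  proof (induction k)
    case 0
    then show ?case using G_finite by (auto simp: Fix_def intro: card_mono)
  next
    case (Suc k)
    have "Fix 0 (int k + 1) \<subset> Fix 0 (int k)" using * Fix_mono[of 0 0 "int k" "int k + 1"] by auto
    then have "card (Fix 0 (int k + 1)) < card (Fix 0 (int k))"
      by (rule psubset_card_mono[OF finite_Fix])
    with Suc show ?case by (simp add: add.commute)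
  qed
  from this[of "Suc (card G)"] show False by simp
qed

lemma n_stable: "Fix 0 (int n) \<subseteq> Fix 0 (int n + 1)"
  unfolding n_def using n_exists by (rule LeastI_ex)

lemma n_least: "k < n \<Longrightarrow> \<exists>h \<in> Fix 0 (int k). act h (\<omega> (int k + 1)) \<noteq> \<omega> (int k + 1)"
proof (rule ccontr)
  assume k: "k < n" and *: "\<not> ?thesis"
  have "Fix 0 (int k) \<subseteq> Fix 0 (int k + 1)"
  proof
    fix g assume g: "g \<in> Fix 0 (int k)"
    show "g \<in> Fix 0 (int k + 1)"
    proof (rule FixI)
      show "act g (\<omega> i) = \<omega> i" if "0 \<le> i" "i \<le> int k + 1" for i
        using * g FixD[OF g] that by (cases "i = int k + 1") auto
    qed (use g Fix_G in auto)
  qed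
  then have "n \<le> k" unfolding n_def by (rule Least_le)
  with k show False by simp
qed

lemma n_pos: "0 < n"
proof (rule ccontr)
  assume "\<not> 0 < n"
  then have "Fix 0 0 \<subseteq> Fix 0 1" using n_stable by simp
  moreover obtain g where "g \<in> G" "act g (\<omega> 0) = \<omega> 0" "act g (\<omega> 1) \<noteq> \<omega> 1"
    using moves_succ[OF \<omega>_D[of 0]] \<omega>_succ[of 0] by auto
  moreover from this have "g \<in> Fix 0 0" by (auto simp: Fix_def)
  ultimately show False using FixD[of g 0 1 1] by auto
qed

text \<open>Below \<open>n\<close> the stabiliser of the initial darts still moves the next one; as
  there are two successors, both continuations are reached.\<close>

lemma path_transitive:
  assumes "k \<le> n" "p 0 \<in> D" "\<And>i. i < k \<Longrightarrow> p (Suc i) \<in> succ (p i)"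
  shows "\<exists>g \<in> G. \<forall>i \<le> k. act g (\<omega> (int i)) = p i"
  using assms
proof (induction k)
  case 0
  then show ?case using transitive[OF \<omega>_D[of 0]] by auto
next
  case (Suc k)
  then obtain g where g: "g \<in> G" "\<And>i. i \<le> k \<Longrightarrow> act g (\<omega> (int i)) = p i" by fastforce
  obtain h where h: "h \<in> Fix 0 (int k)" "act h (\<omega> (int k + 1)) \<noteq> \<omega> (int k + 1)"
    using n_least[of k] Suc.prems by auto
  have pk: "p k \<in> D" using g act_D \<omega>_D by (metis order_refl)
  have gh: "g * h \<in> G" "\<And>i. i \<le> k \<Longrightarrow> act (g * h) (\<omega> (int i)) = p i"
    using g h(1) FixD[OF h(1)] by (auto simp: G_mult Fix_G)
  have "act g (\<omega> (int k + 1)) \<in> succ (p k)" "act (g * h) (\<omega> (int k + 1)) \<in> succ (p k)"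
    using act_succ[OF g(1) \<omega>_D \<omega>_succ, of "int k"] act_succ[OF gh(1) \<omega>_D \<omega>_succ, of "int k"]
      g(2)[of k] gh(2)[of k] by auto
  moreover have "act g (\<omega> (int k + 1)) \<noteq> act (g * h) (\<omega> (int k + 1))"
    using h(2) by (metis act_inverse(1) act_mult)
  moreover have "p (Suc k) \<in> succ (p k)" using Suc.prems by simp
  ultimately have "p (Suc k) = act g (\<omega> (int k + 1)) \<or> p (Suc k) = act (g * h) (\<omega> (int k + 1))"
    using succ_eq[OF pk] by blast
  then obtain f where f: "f \<in> G" "\<And>i. i \<le> k \<Longrightarrow> act f (\<omega> (int i)) = p i"
    "act f (\<omega> (int k + 1)) = p (Suc k)"
    using g gh by metis
  have "act f (\<omega> (int i)) = p i" if "i \<le> Suc k" for i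
    using f that by (cases "i = Suc k") (auto simp: add.commute)
  with f(1) show ?case by blast
qed

lemma bar_\<omega>: "bar (\<omega> i) \<in> D" "bar (bar (\<omega> i)) = \<omega> i" "bar (\<omega> i) \<in> succ (bar (\<omega> (i + 1)))"
  by (simp_all add: bar_D bar_bar \<omega>_D bar_succ \<omega>_succ)

lemma obtain_reversal:
  obtains \<rho> where "\<rho> \<in> G" "\<And>i. 0 \<le> i \<Longrightarrow> i \<le> int n \<Longrightarrow> act \<rho> (\<omega> i) = bar (\<omega> (int n - i))"
proof -
  have "\<exists>g \<in> G. \<forall>i \<le> n. act g (\<omega> (int i)) = bar (\<omega> (int n - int i))"
  proof (rule path_transitive)
    show "bar (\<omega> (int n - int (Suc i))) \<in> succ (bar (\<omega> (int n - int i)))" for i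
      using bar_\<omega>(3)[of "int n - int (Suc i)"] by simp
  qed (simp_all add: bar_\<omega>)
  then obtain \<rho> where \<rho>: "\<rho> \<in> G" "\<And>i. i \<le> n \<Longrightarrow> act \<rho> (\<omega> (int i)) = bar (\<omega> (int n - int i))"
    by blast
  have "act \<rho> (\<omega> i) = bar (\<omega> (int n - i))" if "0 \<le> i" "i \<le> int n" for i
    using \<rho>(2)[of "nat i"] that by simp
  with \<rho>(1) show thesis by (rule that)
qed

text \<open>
  The stabiliser \<open>S\<close> of the path fixes both of its continuations, so it is the stabiliser of all
  shifts and of the reversal of the path. The elements of \<open>G\<close> realising these normalise \<open>S\<close>, and
  they reach every dart.
\<close>

lemma Fix_trivial_0: "Fix 0 (int n) = {1}"
proof -
  define S where "S = Fix 0 (int n)"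
  \<comment> \<open>Only an inclusion is demanded. \<open>S\<close> being finite, it is an equality,
    and \<open>N\<close> is closed under inverses.\<close>
  define N where "N = {g \<in> G. \<forall>s \<in> S. inverse g * s * g \<in> S}"
  have NI: "g \<in> N" if "g \<in> G" "\<And>s i. s \<in> S \<Longrightarrow> 0 \<le> i \<Longrightarrow> i \<le> int n \<Longrightarrow> act s (act g (\<omega> i)) = act g (\<omega> i)" for g
    unfolding N_def S_def using that
    by (auto intro!: FixI G_mult G_inverse simp: S_def Fix_G)
  have N_inverse: "inverse g \<in> N" if g: "g \<in> N" for g
  proof -
    have "inj_on (\<lambda>s. inverse g * s * g) S"
      by (rule inj_onI) (simp add: perm.left_cancel perm.right_cancel mult.assoc)
    moreover have "(\<lambda>s. inverse g * s * g) ` S \<subseteq> S" using g by (auto simp: N_def)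
    moreover have "finite S" unfolding S_def by (rule finite_Fix)
    ultimately have im: "(\<lambda>s. inverse g * s * g) ` S = S" by (simp add: endo_inj_surj)
    have "g * s * inverse g \<in> S" if "s \<in> S" for s
    proof -
      have "s \<in> (\<lambda>s. inverse g * s * g) ` S" using im that by simp
      then obtain s' where "s = inverse g * s' * g" "s' \<in> S" by (rule imageE)
      then show ?thesis by (simp add: mult.assoc)
    qed
    then show ?thesis using g by (simp add: N_def G_inverse)
  qed
  have N_mult: "g * h \<in> N" if "g \<in> N" "h \<in> N" for g h
  proof -
    have "inverse (g * h) * s * (g * h) = inverse h * (inverse g * s * g) * h" for s
      by (simp add: mult.assoc)
    then show ?thesis using that by (simp add: N_def G_mult)
  qed
  have S_\<omega>: "act s (\<omega> i) = \<omega> i" if "s \<in> S" "0 \<le> i" "i \<le> int n + 1" for s i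
    using that n_stable FixD unfolding S_def by blast
  have tN: "t \<in> N" by (rule NI) (simp_all add: t act_t S_\<omega>)
  obtain h0 where h0: "h0 \<in> Fix 0 (int n - 1)" "act h0 (\<omega> (int n)) \<noteq> \<omega> (int n)"
    using n_least[of "n - 1"] n_pos by (auto simp: of_nat_diff)
  \<comment> \<open>\<open>h\<close> takes \<open>\<omega> (int n + 1)\<close> to the other
    successor of \<open>\<omega> (int n)\<close>, so \<open>t\<close> and \<open>h * t\<close>
    together reach both successors.\<close>
  define h where "h = t * h0 * inverse t"
  have h: "h \<in> Fix 1 (int n)" using h0(1) Fix_shift[of h0 0 "int n - 1"] by (simp add: h_def)
  have hG: "h \<in> G" using h by (rule Fix_G)
  have h_moves: "act h (\<omega> (int n + 1)) \<noteq> \<omega> (int n + 1)"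
    using h0(2) by (simp add: h_def act_t_inverse) (metis act_inverse(1) act_t)
  have h_succ: "act h (\<omega> (int n + 1)) \<in> succ (\<omega> (int n))"
    using act_succ[OF hG \<omega>_D \<omega>_succ, of "int n"] FixD[OF h, of "int n"] n_pos by simp
  have succ_n: "succ (\<omega> (int n)) = {\<omega> (int n + 1), act h (\<omega> (int n + 1))}"
    using succ_eq[OF \<omega>_D \<omega>_succ h_succ] h_moves by metis
  have S_h: "act s (act h (\<omega> (int n + 1))) = act h (\<omega> (int n + 1))" if "s \<in> S" for s
  proof -
    have sG: "s \<in> G" using that Fix_G S_def by blast
    have "act s (act h (\<omega> (int n + 1))) \<in> succ (\<omega> (int n))"
      using act_succ[OF sG \<omega>_D h_succ] S_\<omega>[OF that, of "int n"] by simp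
    moreover have "act s (act h (\<omega> (int n + 1))) \<noteq> act s (\<omega> (int n + 1))"
      using h_moves by (metis act_inverse(1))
    ultimately show ?thesis using succ_n S_\<omega>[OF that, of "int n + 1"] by auto
  qed
  have htN: "h * t \<in> N"
  proof (rule NI)
    show "act s (act (h * t) (\<omega> i)) = act (h * t) (\<omega> i)" if "s \<in> S" "0 \<le> i" "i \<le> int n" for s i
      using that S_h[OF that(1)] S_\<omega>[of s "i + 1"] FixD[OF h, of "i + 1"]
      by (cases "i = int n") (auto simp: act_t)
  qed (simp add: hG t G_mult)
  obtain \<rho> where \<rho>: "\<rho> \<in> G" "\<And>i. 0 \<le> i \<Longrightarrow> i \<le> int n \<Longrightarrow> act \<rho> (\<omega> i) = bar (\<omega> (int n - i))"
    by (rule obtain_reversal) blast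
  have \<rho>N: "\<rho> \<in> N"
    using \<rho> S_\<omega> by (intro NI) (auto simp: act_bar_fixed \<omega>_D S_def Fix_G)
  define F where "F = (\<lambda>g. act g (\<omega> (int n))) ` N"
  have N_G: "g \<in> G" if "g \<in> N" for g using that by (simp add: N_def)
  have F_act: "act g d \<in> F" if "g \<in> N" "d \<in> F" for g d
    using that N_mult by (auto simp: F_def simp flip: act_mult)
  have oneN: "1 \<in> N" by (simp add: N_def G_one)
  have \<omega>_F: "\<omega> i \<in> F" for i
  proof (induction i rule: int_induct[where k = "int n"])
    case base
    show ?case using oneN by (auto simp: F_def intro!: image_eqI[of _ _ 1])
  next
    case (step1 i)
    then show ?case using F_act[OF tN] act_t by metis
  next
    case (step2 i)
    then show ?case using F_act[OF N_inverse[OF tN]] act_t_inverse by metis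
  qed
  have "F = D"
  proof (rule connected)
    show "F \<subseteq> D" by (auto simp: F_def intro!: act_D N_G \<omega>_D)
    show "F \<noteq> {}" using \<omega>_F by blast
    show "e \<in> F" if d: "d \<in> F" and e: "e \<in> succ d" for d e
    proof -
      obtain g where g: "g \<in> N" "d = act g (\<omega> (int n))" using d by (auto simp: F_def)
      have "act (inverse g) e \<in> succ (\<omega> (int n))"
        using act_succ[OF G_inverse[OF N_G[OF g(1)]] _ e] g \<open>F \<subseteq> D\<close> d by auto
      then have "act (inverse g) e = act t (\<omega> (int n)) \<or> act (inverse g) e = act (h * t) (\<omega> (int n))"
        using succ_n by (auto simp: act_t)
      then have "act (inverse g) e \<in> F"
        using F_act[OF tN \<omega>_F] F_act[OF htN \<omega>_F] by metis
      then show ?thesis using F_act[OF g(1)] by fastforce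
    qed
    show "bar d \<in> F" if d: "d \<in> F" for d
    proof -
      obtain g where g: "g \<in> N" "d = act g (\<omega> (int n))" using d by (auto simp: F_def)
      have "bar d = act g (act \<rho> (\<omega> 0))"
        using g \<rho>(2)[of 0] act_bar[OF N_G[OF g(1)] \<omega>_D] by simp
      then show ?thesis using F_act[OF g(1) F_act[OF \<rho>N \<omega>_F]] by simp
    qed
  qed
  have "s = 1" if s: "s \<in> S" for s
  proof (rule faithful)
    show "s \<in> G" using s Fix_G S_def by blast
    fix d assume "d \<in> D"
    with \<open>F = D\<close> have "d \<in> F" by simp
    then obtain g where g: "d = act g (\<omega> (int n))" "g \<in> N" unfolding F_def by (rule imageE)
    have "inverse g * s * g \<in> S" using g s by (simp add: N_def)
    then have "act (inverse g * s * g) (\<omega> (int n)) = \<omega> (int n)" by (rule S_\<omega>) simp_all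
    then show "act s d = d" by (simp add: g act_eq_iff[of "inverse g"]) 
  qed
  then show ?thesis using Fix_one unfolding S_def by blast
qed

section \<open>Stabilisers of paths with \<open>n\<close> or more darts\<close>

lemma Fix_trivial:
  assumes "g \<in> Fix a b" "a + int n \<le> b"
  shows "g = 1"
proof -
  have "g = 1" if "g \<in> Fix a (a + int n)" for g
    using that
  proof (induction a arbitrary: g rule: int_induct[where k = 0])
    case base
    then show ?case using Fix_trivial_0 by simp
  next
    case (step1 i)
    have "g \<in> Fix (i + 1) (i + int n + 1)" using step1.prems by (simp add: ac_simps)
    then have "inverse t * g * t = 1"
      by (intro step1.IH) (simp only: Fix_shift_back)
    then show ?case by (metis mult.assoc mult.left_neutral perm.left_cancel perm.left_inverse perm.right_cancel)
  next
    case (step2 i)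
    then have "t * g * inverse t = 1"
      using Fix_shift[of g "i - 1" "i - 1 + int n"] by (intro step2.IH) simp
    then show ?case by (metis mult.left_neutral mult.right_neutral perm.left_cancel perm_conj_eq_iff)
  qed
  then show ?thesis using assms Fix_mono[of a a "a + int n" b] by blast
qed

text \<open>The choice is not arbitrary: by \<open>x_unique\<close> there is only one candidate.
  This is what forces the conjugation rules for \<open>t\<close> and the reversal.\<close>

definition x :: "int \<Rightarrow> 'a perm" where
  "x i = (SOME g. g \<in> Fix i (i + int n - 1) \<and> g \<noteq> 1)"

lemma x: "x i \<in> Fix i (i + int n - 1)" "x i \<noteq> 1"
proof -
  have "\<exists>g \<in> Fix i (i + int n - 1). g \<noteq> 1"
  proof (induction i rule: int_induct[where k = 0])
    case base
    obtain g where "g \<in> Fix 0 (int n - 1)" "act g (\<omega> (int n)) \<noteq> \<omega> (int n)"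
      using n_least[of "n - 1"] n_pos by (auto simp: of_nat_diff)
    moreover from this have "g \<noteq> 1" by auto
    ultimately show ?case by auto
  next
    case (step1 i)
    then obtain g where "g \<in> Fix i (i + int n - 1)" "g \<noteq> 1" by blast
    moreover from this have "t * g * inverse t \<in> Fix (i + 1) (i + 1 + int n - 1)"
      using Fix_shift[of g i "i + int n - 1"] by (simp add: ac_simps)
    ultimately show ?case by (metis perm_conj_eq_iff mult.left_neutral mult.right_neutral perm.left_cancel)
  next
    case (step2 i)
    then obtain g where g: "g \<in> Fix i (i + int n - 1)" "g \<noteq> 1" by blast
    then have "inverse t * g * t \<in> Fix (i - 1) (i - 1 + int n - 1)"
      using Fix_shift_back[of g "i - 1" "i - 1 + int n - 1"] by simp
    moreover have "inverse t * g * t \<noteq> 1"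
      using g(2) by (metis mult.assoc mult.left_neutral perm.left_inverse perm.left_cancel perm.right_cancel)
    ultimately show ?case by blast
  qed
  then have "x i \<in> Fix i (i + int n - 1) \<and> x i \<noteq> 1"
    unfolding x_def by (metis (mono_tags, lifting) someI_ex)
  then show "x i \<in> Fix i (i + int n - 1)" "x i \<noteq> 1" by blast+
qed

lemma x_G: "x i \<in> G"
  using x(1) by (rule Fix_G)

lemma x_fixes: "i \<le> j \<Longrightarrow> j < i + int n \<Longrightarrow> act (x i) (\<omega> j) = \<omega> j"
  using FixD[OF x(1)] by simp

lemma x_moves_right: "act (x i) (\<omega> (i + int n)) \<noteq> \<omega> (i + int n)"
proof
  assume *: "act (x i) (\<omega> (i + int n)) = \<omega> (i + int n)"
  have "act (x i) (\<omega> j) = \<omega> j" if "i \<le> j" "j \<le> i + int n" for j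
    using * x_fixes that by (cases "j = i + int n") auto
  then have "x i = 1" using Fix_trivial[of "x i" i "i + int n"] x_G by (auto intro: FixI)
  with x(2) show False by blast
qed

lemma x_moves_left: "act (x i) (\<omega> (i - 1)) \<noteq> \<omega> (i - 1)"
proof
  assume *: "act (x i) (\<omega> (i - 1)) = \<omega> (i - 1)"
  have "act (x i) (\<omega> j) = \<omega> j" if "i - 1 \<le> j" "j \<le> i - 1 + int n" for j
    using * x_fixes that by (cases "j = i - 1") auto
  then have "x i = 1" using Fix_trivial[of "x i" "i - 1" "i - 1 + int n"] x_G by (auto intro: FixI)
  with x(2) show False by blast
qed

text \<open>The group induced on the two successors of \<open>\<omega> b\<close>, or on the two
  predecessors of \<open>\<omega> a\<close>, has order at most 2, so a square fixes one more dart at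
  each end.\<close>

lemma Fix_square:
  assumes "g \<in> Fix a b" "a \<le> b"
  shows "g * g \<in> Fix (a - 1) (b + 1)"
proof (rule FixI)
  note g = Fix_G[OF assms(1)] FixD[OF assms(1)]
  show "act (g * g) (\<omega> i) = \<omega> i" if "a - 1 \<le> i" "i \<le> b + 1" for i
    using two_succ(1)[OF \<omega>_D g(1) _ g(1) _ \<omega>_succ, of b] two_pred(1)[OF \<omega>_D \<omega>_succ g(1) _ g(1), of "a - 1"]
      g(2) that assms(2)
    by (cases "i = a - 1"; cases "i = b + 1") auto
qed (simp add: Fix_G[OF assms(1)] G_mult)

lemma Fix_inverse:
  assumes "g \<in> Fix a b"
  shows "inverse g \<in> Fix a b"
proof (rule FixI)
  show "act (inverse g) (\<omega> i) = \<omega> i" if "a \<le> i" "i \<le> b" for i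
    using FixD[OF assms that] by (metis act_inverse(1))
qed (simp add: Fix_G[OF assms] G_inverse)

text \<open>The groups induced at the two ends have order at most 2 and are therefore
  abelian.\<close>

lemma Fix_commutator:
  assumes "g \<in> Fix a b" "h \<in> Fix a b" "a \<le> b"
  shows "g * h * inverse g * inverse h \<in> Fix (a - 1) (b + 1)"
proof (rule FixI)
  define g' h' where "g' = inverse g" and "h' = inverse h"
  have "g' \<in> Fix a b" "h' \<in> Fix a b" using assms Fix_inverse by (simp_all add: g'_def h'_def)
  note g = Fix_G[OF this(1)] FixD[OF this(1)] and h = Fix_G[OF this(2)] FixD[OF this(2)]
  have "act g' (act h' (\<omega> i)) = act h' (act g' (\<omega> i))" if "a - 1 \<le> i" "i \<le> b + 1" for i
    using two_succ(2)[OF \<omega>_D g(1) _ h(1) _ \<omega>_succ, of b] two_pred(2)[OF \<omega>_D \<omega>_succ g(1) _ h(1), of "a - 1"]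
      g(2) h(2) that assms(3)
    by (cases "i = a - 1"; cases "i = b + 1") auto
  then show "act (g * h * inverse g * inverse h) (\<omega> i) = \<omega> i" if "a - 1 \<le> i" "i \<le> b + 1" for i
    using that by (simp add: g'_def h'_def)
qed (simp add: Fix_G[OF assms(1)] Fix_G[OF assms(2)] G_mult G_inverse)

text \<open>\<open>x a\<close> fixes the path and moves \<open>\<omega> (a - 1)\<close>. With only
  two predecessors of \<open>\<omega> a\<close>, it corrects any \<open>g\<close> that moves this
  dart as well.\<close>

lemma Fix_split_left:
  assumes "g \<in> Fix a b" "a \<le> b" "b < a + int n"
  shows "g \<in> Fix (a - 1) b \<or> x a * g \<in> Fix (a - 1) b"
proof (cases "act g (\<omega> (a - 1)) = \<omega> (a - 1)")
  case True
  then have "act g (\<omega> i) = \<omega> i" if "a - 1 \<le> i" "i \<le> b" for i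
    using FixD[OF assms(1), of i] that by (cases "i = a - 1") auto
  then show ?thesis using Fix_G[OF assms(1)] by (blast intro: FixI)
next
  case False
  have "act (x a) (act g (\<omega> (a - 1))) = \<omega> (a - 1)"
    using two_pred(3)[OF \<omega>_D \<omega>_succ Fix_G[OF assms(1)] _ x_G, of "a - 1" a]
      FixD[OF assms(1), of a] x_fixes[of a a] x_moves_left[of a] n_pos False assms by simp
  then have "act (x a * g) (\<omega> i) = \<omega> i" if "a - 1 \<le> i" "i \<le> b" for i
    using FixD[OF assms(1), of i] x_fixes[of a i] assms that by (cases "i = a - 1") auto
  then show ?thesis using Fix_G[OF assms(1)] x_G by (blast intro: FixI G_mult)
qed

lemma Fix_split_right:
  assumes "g \<in> Fix a b" "a \<le> b" "b < a + int n"
  shows "g \<in> Fix a (b + 1) \<or> x (b - int n + 1) * g \<in> Fix a (b + 1)"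
proof -
  \<comment> \<open>\<open>x c\<close> fixes \<open>\<omega> c\<close>, ...,
    \<open>\<omega> b\<close> and moves \<open>\<omega> (b + 1)\<close>; the bound on
    \<open>b\<close> gives \<open>c \<le> a\<close>.\<close>
  define c where "c = b - int n + 1"
  note g = Fix_G[OF assms(1)] FixD[OF assms(1)]
  show ?thesis
  proof (cases "act g (\<omega> (b + 1)) = \<omega> (b + 1)")
    case True
    then have "act g (\<omega> i) = \<omega> i" if "a \<le> i" "i \<le> b + 1" for i
      using g(2)[of i] that by (cases "i = b + 1") auto
    then show ?thesis using g(1) by (blast intro: FixI)
  next
    case False
    have "act (x c) (act g (\<omega> (b + 1))) = \<omega> (b + 1)"
      using two_succ(3)[OF \<omega>_D g(1) _ x_G _ \<omega>_succ, of b c]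
        g(2)[of b] x_fixes[of c b] x_moves_right[of c] n_pos False assms(2) by (simp add: c_def)
    then have "act (x c * g) (\<omega> i) = \<omega> i" if "a \<le> i" "i \<le> b + 1" for i
      using g(2)[of i] x_fixes[of c i] assms that by (cases "i = b + 1") (auto simp: c_def)
    then show ?thesis unfolding c_def using g(1) x_G by (blast intro: FixI G_mult)
  qed
qed

lemma x_unique:
  assumes "g \<in> Fix i (i + int n - 1)" "g \<noteq> 1"
  shows "g = x i"
proof -
  have "g \<notin> Fix (i - 1) (i + int n - 1)" using assms Fix_trivial by fastforce
  then have "x i * g \<in> Fix (i - 1) (i + int n - 1)"
    using Fix_split_left[OF assms(1)] n_pos by auto
  then have 1: "x i * g = 1" by (rule Fix_trivial) simp
  have "x i * x i \<in> Fix (i - 1) (i + int n)"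
    using Fix_square[OF x(1)] n_pos by (simp add: add.commute)
  then have "x i * x i = 1" by (rule Fix_trivial) simp
  with 1 show ?thesis by (metis perm.left_cancel)
qed

lemma conj_neq_1: "g * h * inverse g \<noteq> 1 \<longleftrightarrow> h \<noteq> (1 :: 'a perm)"
  by (metis mult.left_neutral mult.right_neutral perm.left_cancel perm_conj_eq_iff)

text \<open>The segments of \<open>n\<close> darts fixed by \<open>x a\<close>, ...,
  \<open>x b\<close> have \<open>\<omega> b\<close>, ..., \<open>\<omega> (a + int n - 1)\<close> in
  common, which explains the choice of \<open>W a b\<close>.\<close>

lemma chain:
  obtains \<rho> where "involution_chain (int n) x (\<lambda>a b. Fix b (a + int n - 1)) t \<rho>"
proof -
  obtain \<rho> where \<rho>: "\<rho> \<in> G" "\<And>i. 0 \<le> i \<Longrightarrow> i \<le> int n \<Longrightarrow> act \<rho> (\<omega> i) = bar (\<omega> (int n - i))"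
    by (rule obtain_reversal) blast
  have \<rho>': "act (inverse \<rho>) (bar (\<omega> i)) = \<omega> (int n - i)" if "0 \<le> i" "i \<le> int n" for i
    using arg_cong[OF \<rho>(2)[of "int n - i"], of "act (inverse \<rho>)"] that by simp
  have \<rho>_Fix: "\<rho> * g * inverse \<rho> \<in> Fix a b"
    if g: "g \<in> Fix (int n - b) (int n - a)" and ab: "0 \<le> a" "b \<le> int n" for g a b
  proof (rule FixI)
    show *: "\<rho> * g * inverse \<rho> \<in> G" using \<rho> Fix_G[OF g] by (simp add: G_mult G_inverse)
    show "act (\<rho> * g * inverse \<rho>) (\<omega> i) = \<omega> i" if "a \<le> i" "i \<le> b" for i
    proof -
      have "act (\<rho> * g * inverse \<rho>) (bar (\<omega> i)) = bar (\<omega> i)"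
        using that ab \<rho>'[of i] FixD[OF g, of "int n - i"] \<rho>(2)[of "int n - i"] by simp
      then show ?thesis using act_bar_fixed[OF * \<omega>_D] by simp
    qed
  qed
  have "involution_chain (int n) x (\<lambda>a b. Fix b (a + int n - 1)) t \<rho>"
  proof
    show "0 < int n" using n_pos by simp
    show "1 \<in> Fix b (a + int n - 1)" for a b by (rule Fix_one)
    show "g * h \<in> Fix b (a + int n - 1)" if "g \<in> Fix b (a + int n - 1)" "h \<in> Fix b (a + int n - 1)" for g h a b
      using that by (rule Fix_mult)
    show "Fix b (a + int n - 1) \<subseteq> Fix b' (a' + int n - 1)" if "a' \<le> a" "b \<le> b'" for a a' b b'
      using that by (intro Fix_mono) auto
    show "g \<in> Fix b (a' + int n - 1)"
      if g: "g \<in> Fix b (a + int n - 1)" "g \<in> Fix b' (a' + int n - 1)" and "a \<le> a'" "b \<le> b'" "b' \<le> a + int n"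
      for g a b a' b'
    proof (rule FixI)
      show "g \<in> G" using g Fix_G by blast
      \<comment> \<open>\<open>b' \<le> a + int n\<close> means that there is no gap between the two
        segments.\<close>
      show "act g (\<omega> i) = \<omega> i" if "b \<le> i" "i \<le> a' + int n - 1" for i
        using FixD[OF g(1), of i] FixD[OF g(2), of i] that \<open>b' \<le> a + int n\<close> by linarith
    qed
    show "g = 1" if "g \<in> Fix b (a + int n - 1)" "b < a" for g a b
      using that by (intro Fix_trivial) auto
    show "x i \<in> Fix i (i + int n - 1)" for i by (rule x)
    show "g \<in> Fix (b - 1) (a + int n - 1) \<or> x b * g \<in> Fix (b - 1) (a + int n - 1)"
      if "g \<in> Fix b (a + int n - 1)" "a \<le> b" "b < a + int n" for g a b
      using that by (intro Fix_split_left) auto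
    show "g \<in> Fix b (a + 1 + int n - 1) \<or> x a * g \<in> Fix b (a + 1 + int n - 1)"
      if "g \<in> Fix b (a + int n - 1)" "a \<le> b" "b < a + int n" for g a b
      using Fix_split_right[of g b "a + int n - 1"] that by (simp add: algebra_simps)
    show "g * h * inverse g * inverse h \<in> Fix (b - 1) (a + 1 + int n - 1)"
      if "g \<in> Fix b (a + int n - 1)" "h \<in> Fix b (a + int n - 1)" "b < a + int n" for g h a b
      using Fix_commutator[OF that(1,2)] that(3) by (simp add: algebra_simps)
    show "g * g \<in> Fix (b - 1) (a + 1 + int n - 1)" if "g \<in> Fix b (a + int n - 1)" "b < a + int n" for g a b
      using Fix_square[OF that(1)] that(2) by (simp add: algebra_simps)
    show "t * g * inverse t \<in> Fix (b + 1) (a + 1 + int n - 1) \<longleftrightarrow> g \<in> Fix b (a + int n - 1)" for g a b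
      using Fix_shift[of g b "a + int n - 1"] by (simp add: algebra_simps)
    show "t * x i * inverse t = x (i + 1)" for i
    proof (rule x_unique)
      show "t * x i * inverse t \<in> Fix (i + 1) (i + 1 + int n - 1)"
        using Fix_shift[of "x i" i "i + int n - 1"] x(1) by (simp add: algebra_simps)
    qed (simp only: conj_neq_1 x not_False_eq_True)
    show "\<rho> * x 0 * inverse \<rho> = x 1"
    proof (rule x_unique)
      show "\<rho> * x 0 * inverse \<rho> \<in> Fix 1 (1 + int n - 1)" using x(1)[of 0] by (intro \<rho>_Fix) auto
    qed (simp only: conj_neq_1 x not_False_eq_True)
    show "\<rho> * x 1 * inverse \<rho> = x 0"
    proof (rule x_unique)
      show "\<rho> * x 1 * inverse \<rho> \<in> Fix 0 (0 + int n - 1)" using x(1)[of 1] by (intro \<rho>_Fix) auto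
    qed (simp only: conj_neq_1 x not_False_eq_True)
    \<comment> \<open>Since \<open>\<rho>\<close> is known on \<open>\<omega> 0\<close>, ...,
      \<open>\<omega> (int n)\<close> only, the product is controlled on the \<open>n\<close> darts
      from \<open>\<omega> 1\<close> on, whose stabiliser still contains \<open>x 1\<close>.\<close>
    show "t * \<rho> * t * inverse \<rho> \<in> {1, x 1}"
    proof -
      have *: "t * \<rho> * t * inverse \<rho> \<in> G" using t \<rho> by (simp add: G_mult G_inverse)
      have "t * \<rho> * t * inverse \<rho> \<in> Fix 1 (1 + int n - 1)"
      proof (rule FixI[OF *])
        fix i assume i: "1 \<le> i" "i \<le> 1 + int n - 1"
        have "act (t * \<rho> * t * inverse \<rho>) (bar (\<omega> i)) = act t (bar (\<omega> (i - 1)))"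
          using i \<rho>'[of i] \<rho>(2)[of "int n - i + 1"] by (simp add: act_t algebra_simps)
        also have "\<dots> = bar (\<omega> i)" using t by (simp add: act_bar \<omega>_D act_t)
        finally show "act (t * \<rho> * t * inverse \<rho>) (\<omega> i) = \<omega> i"
          using act_bar_fixed[OF * \<omega>_D] by simp
      qed
      then show ?thesis using x_unique by blast
    qed
  qed
  then show thesis by (rule that)
qed

lemma exponent_4_\<omega>: "g \<in> Fix (int n - 1) (int n - 1) \<Longrightarrow> g ^ 4 = 1"
proof -
  obtain \<rho> where "involution_chain (int n) x (\<lambda>a b. Fix b (a + int n - 1)) t \<rho>" by (rule chain)
  then interpret involution_chain "int n" x "\<lambda>a b. Fix b (a + int n - 1)" t \<rho> .
  show "g \<in> Fix (int n - 1) (int n - 1) \<Longrightarrow> g ^ 4 = 1"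
    using chain_exponent_4[of g] by simp
qed

text \<open>\<open>W 1 (n - 1)\<close> becomes the stabiliser of two consecutive darts,
  \<open>W 2 (n - 2)\<close> that of four. Two consecutive arcs fix a vertex with all its
  neighbours.\<close>

lemma kernel_\<omega>:
  "(\<forall>g \<in> Fix (int n - 1) (int n). g * g = 1) \<or>
    2 < n \<and> x 0 * x (int n) * x 1 * x (int n) * x 0 * x 1 \<in> Fix (int n - 2) (int n + 1)"
proof -
  obtain \<rho> where "involution_chain (int n) x (\<lambda>a b. Fix b (a + int n - 1)) t \<rho>" by (rule chain)
  then interpret involution_chain "int n" x "\<lambda>a b. Fix b (a + int n - 1)" t \<rho> .
  show ?thesis using chain_kernel_alternative by (simp add: add.commute)
qed

lemma x_involution: "x i * x i = 1"
proof -
  have "x i * x i \<in> Fix (i - 1) (i + int n)"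
    using Fix_square[OF x(1)] n_pos by (simp add: add.commute)
  then show ?thesis by (rule Fix_trivial) simp
qed

end

section \<open>Existence of a line, and the stabiliser of a dart\<close>

context dart_action
begin

lemma obtain_line:
  obtains t \<omega> where "dart_line G act D succ bar t \<omega>"
proof -
  obtain d where d: "d \<in> D" using D_nonempty by blast
  obtain e where e: "e \<in> succ d" using succ_nonempty[OF d] by blast
  obtain t where t: "t \<in> G" "act t d = e" using transitive d e succ_in_D by blast
  define \<omega> where "\<omega> i = (if 0 \<le> i then act (t ^ nat i) d else act (inverse t ^ nat (- i)) d)" for i :: int
  have act_t: "act t (\<omega> i) = \<omega> (i + 1)" for i
  proof -
    consider "0 \<le> i" | "i = - 1" | "i < - 1" by linarith
    then show ?thesis
    proof cases
      case 1
      then show ?thesis by (simp add: \<omega>_def nat_add_distrib)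
    next
      case 3
      then have "nat (- i) = Suc (nat (- (i + 1)))" by simp
      with 3 show ?thesis by (simp add: \<omega>_def del: nat_minus_as_int)
    qed (simp add: \<omega>_def)
  qed
  have t_power: "t ^ k \<in> G" "inverse t ^ k \<in> G" for k
    by (induction k) (simp_all add: G_one G_mult G_inverse t)
  \<comment> \<open>An element commuting with \<open>t\<close> that takes \<open>d\<close> to
    \<open>\<omega> i\<close> also takes \<open>e = act t d\<close> to
    \<open>\<omega> (i + 1)\<close>, which carries the successor relation along the line.\<close>
  have \<omega>_act: "\<exists>g \<in> G. \<omega> i = act g d \<and> g * t = t * g" for i
  proof -
    have "t ^ k * t = t * t ^ k" "inverse t ^ k * t = t * inverse t ^ k" for k
      by (simp_all add: power_commutes perm_power_inverse)
        (metis mult.assoc perm_cancel power_commutes perm.right_inverse mult.right_neutral)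
    then show ?thesis unfolding \<omega>_def using t_power by (cases "0 \<le> i") auto
  qed
  have "dart_line G act D succ bar t \<omega>"
  proof
    show "t \<in> G" by (rule t)
    show "act t (\<omega> i) = \<omega> (i + 1)" for i by (rule act_t)
    show "\<omega> i \<in> D" for i using \<omega>_act[of i] act_D d by auto
    show "\<omega> (i + 1) \<in> succ (\<omega> i)" for i
    proof -
      obtain g where g: "g \<in> G" "\<omega> i = act g d" "g * t = t * g" using \<omega>_act by blast
      have "\<omega> (i + 1) = act g e" using act_t[of i] g t by (metis act_mult)
      then show ?thesis using act_succ[OF g(1) d e] g by simp
    qed
  qed
  then show thesis by (rule that)
qed

theorem exponent_4:
  assumes "g \<in> G" "d \<in> D" "act g d = d"
  shows "g ^ 4 = 1"
proof -
  obtain t \<omega> where "dart_line G act D succ bar t \<omega>" by (rule obtain_line)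
  then interpret dart_line G act D succ bar t \<omega> .
  obtain h where h: "h \<in> G" "act h d = \<omega> (int n - 1)" using transitive \<omega>_D assms by blast
  have "h * g * inverse h \<in> Fix (int n - 1) (int n - 1)"
    using h assms by (intro FixI) (auto simp: G_mult G_inverse simp flip: h(2))
  then have "(h * g * inverse h) ^ 4 = 1" by (rule exponent_4_\<omega>)
  then show ?thesis using conj_neq_1[of h "g ^ 4"] by (simp only: perm_conj_power) blast
qed

end

section \<open>Cubic vertex-transitive graphs\<close>

lemma finite_perms_supported:
  assumes "finite V"
  shows "finite {p :: 'a perm. \<forall>v. v \<notin> V \<longrightarrow> p \<langle>$\<rangle> v = v}"
proof (rule finite_imageD)
  let ?P = "{p :: 'a perm. \<forall>v. v \<notin> V \<longrightarrow> p \<langle>$\<rangle> v = v}"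
  let ?r = "\<lambda>p. restrict (apply p) V"
  have "p \<langle>$\<rangle> v \<in> V" if "p \<in> ?P" "v \<in> V" for p v
  proof (rule ccontr)
    assume "p \<langle>$\<rangle> v \<notin> V"
    then have "p \<langle>$\<rangle> (p \<langle>$\<rangle> v) = p \<langle>$\<rangle> v" using that(1) by blast
    then have "p \<langle>$\<rangle> v = v" by (simp only: apply_inj)
    with that(2) \<open>p \<langle>$\<rangle> v \<notin> V\<close> show False by simp
  qed
  then have "?r ` ?P \<subseteq> V \<rightarrow>\<^sub>E V" by (auto simp: PiE_def)
  then show "finite (?r ` ?P)"
    by (rule finite_subset) (use assms in \<open>auto intro: finite_PiE\<close>)
  show "inj_on ?r ?P"
  proof (rule inj_onI, rule perm_eqI)
    fix p q v
    assume pq: "p \<in> ?P" "q \<in> ?P" "?r p = ?r q"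
    show "p \<langle>$\<rangle> v = q \<langle>$\<rangle> v"
    proof (cases "v \<in> V")
      case True
      then show ?thesis using fun_cong[OF pq(3), of v] by simp
    qed (use pq in simp)
  qed
qed

text \<open>Automorphisms extended by the identity off \<open>V\<close>, so that the group
  operations of type \<open>perm\<close> apply. When \<open>E\<close> lies within \<open>V\<close>,
  adjacency can be demanded of all pairs.\<close>

definition graph_perms :: "'a set \<Rightarrow> 'a rel \<Rightarrow> 'a perm set" where
  "graph_perms V E = {p. (\<forall>v. v \<notin> V \<longrightarrow> p \<langle>$\<rangle> v = v) \<and>
    (\<forall>u v. (p \<langle>$\<rangle> u, p \<langle>$\<rangle> v) \<in> E \<longleftrightarrow> (u, v) \<in> E)}"

locale cubic_graph =
  fixes V :: "'a set" and E :: "'a rel"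
  assumes finite_V: "finite V"
    and V_nonempty: "V \<noteq> {}"
    and E_V: "(u, v) \<in> E \<Longrightarrow> u \<in> V \<and> v \<in> V"
    and E_sym: "(u, v) \<in> E \<Longrightarrow> (v, u) \<in> E"
    and cubic: "v \<in> V \<Longrightarrow> card (E `` {v}) = 3"
    and E_connected: "F \<subseteq> V \<Longrightarrow> F \<noteq> {} \<Longrightarrow> (\<And>u v. u \<in> F \<Longrightarrow> (u, v) \<in> E \<Longrightarrow> v \<in> F) \<Longrightarrow> F = V"
    and vertex_trans: "u \<in> V \<Longrightarrow> v \<in> V \<Longrightarrow> \<exists>g \<in> graph_perms V E. g \<langle>$\<rangle> u = v"
begin

abbreviation A :: "'a perm set" where "A \<equiv> graph_perms V E"

definition nb :: "'a \<Rightarrow> 'a set" where "nb v = E `` {v}"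

lemma card_nb: "v \<in> V \<Longrightarrow> card (nb v) = 3"
  by (simp add: nb_def cubic)

lemma A_edge: "g \<in> A \<Longrightarrow> (g \<langle>$\<rangle> u, g \<langle>$\<rangle> v) \<in> E \<longleftrightarrow> (u, v) \<in> E"
  by (simp add: graph_perms_def)

lemma nb_iff: "w \<in> nb v \<longleftrightarrow> (v, w) \<in> E"
  by (simp add: nb_def)

lemma nb_V: "w \<in> nb v \<Longrightarrow> w \<in> V" and nb_V': "w \<in> nb v \<Longrightarrow> v \<in> V"
  using E_V by (auto simp: nb_iff)

lemma nb_sym: "w \<in> nb v \<longleftrightarrow> v \<in> nb w"
  using E_sym by (auto simp: nb_iff)

lemma A_nb: "g \<in> A \<Longrightarrow> g \<langle>$\<rangle> w \<in> nb (g \<langle>$\<rangle> v) \<longleftrightarrow> w \<in> nb v"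
  by (simp add: nb_iff A_edge)

lemma apply_mult [simp]: "(g * h) \<langle>$\<rangle> v = g \<langle>$\<rangle> (h \<langle>$\<rangle> v)"
  by (simp add: apply_times)

lemma apply_inverse_cancel [simp]: "inverse g \<langle>$\<rangle> (g \<langle>$\<rangle> v) = v" "g \<langle>$\<rangle> (inverse g \<langle>$\<rangle> v) = v"
  by (simp_all flip: apply_mult)

lemma A_one: "1 \<in> A"
  by (simp add: graph_perms_def)

lemma A_mult: "g \<in> A \<Longrightarrow> h \<in> A \<Longrightarrow> g * h \<in> A"
  by (simp add: graph_perms_def)

lemma A_inverse:
  assumes "g \<in> A"
  shows "inverse g \<in> A"
proof -
  have "inverse g \<langle>$\<rangle> v = v" if "v \<notin> V" for v
    using assms that apply_inverse_cancel(1)[of g v] by (simp add: graph_perms_def)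
  moreover have "(inverse g \<langle>$\<rangle> u, inverse g \<langle>$\<rangle> v) \<in> E \<longleftrightarrow> (u, v) \<in> E" for u v
    using A_edge[OF assms, of "inverse g \<langle>$\<rangle> u" "inverse g \<langle>$\<rangle> v"] by simp
  ultimately show ?thesis by (simp add: graph_perms_def)
qed

lemma A_V:
  assumes "g \<in> A"
  shows "g \<langle>$\<rangle> v \<in> V \<longleftrightarrow> v \<in> V"
proof -
  have *: "h \<langle>$\<rangle> u \<notin> V" if "h \<in> A" "u \<notin> V" for h u
    using that by (simp add: graph_perms_def)
  from *[OF assms, of v] *[OF A_inverse[OF assms], of "g \<langle>$\<rangle> v"] show ?thesis by auto
qed

lemma finite_A: "finite A"
  using finite_perms_supported[OF finite_V] by (rule finite_subset[rotated]) (auto simp: graph_perms_def)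

lemma A_eqI:
  assumes "g \<in> A" "\<And>v. v \<in> V \<Longrightarrow> g \<langle>$\<rangle> v = v"
  shows "g = 1"
  using assms by (intro perm_eqI) (auto simp: graph_perms_def)

lemma nb_cases:
  assumes "a \<in> nb v" "b \<in> nb v" "a \<noteq> b"
  obtains c where "nb v = {a, b, c}" "c \<noteq> a" "c \<noteq> b"
proof -
  have 3: "card (nb v) = 3" using card_nb nb_V' assms by blast
  then have fin: "finite (nb v)" by (simp add: card_ge_0_finite)
  have "card (nb v - {a, b}) = 1"
    using assms 3 fin by (subst card_Diff_subset) auto
  then obtain c where "nb v - {a, b} = {c}" by (rule card_1_singletonE)
  then have "nb v = {a, b, c}" "c \<noteq> a" "c \<noteq> b" using assms by auto
  then show thesis by (rule that)
qed

lemma nb_third: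
  assumes "a \<in> nb v" "b \<in> nb v" "a \<noteq> b" "c \<in> nb v" "c \<noteq> a" "c \<noteq> b" "d \<in> nb v" "d \<noteq> a" "d \<noteq> b"
  shows "c = d"
  using assms by (metis nb_cases empty_iff insert_iff)

lemma fixes_third:
  assumes "g \<in> A" "g \<langle>$\<rangle> v = v" "a \<in> nb v" "b \<in> nb v" "a \<noteq> b" "g \<langle>$\<rangle> a = a" "g \<langle>$\<rangle> b = b" "c \<in> nb v"
  shows "g \<langle>$\<rangle> c = c"
proof (cases "c = a \<or> c = b")
  case False
  then have "g \<langle>$\<rangle> c \<noteq> a" "g \<langle>$\<rangle> c \<noteq> b" using assms by (metis apply_inj)+
  moreover have "g \<langle>$\<rangle> c \<in> nb v" using A_nb[of g c v] assms by simp
  ultimately show ?thesis using False assms nb_third by metis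
qed (use assms in auto)

text \<open>A permutation of three neighbours without fixed points is a 3-cycle.\<close>

lemma cube_fixes:
  assumes g: "g \<in> A" "g \<langle>$\<rangle> v = v" and no_fixed: "\<And>a. a \<in> nb v \<Longrightarrow> g \<langle>$\<rangle> a \<noteq> a" and a: "a \<in> nb v"
  shows "(g ^ 3) \<langle>$\<rangle> a = a"
proof -
  define b where "b = g \<langle>$\<rangle> a"
  have closed: "g \<langle>$\<rangle> w \<in> nb v" if "w \<in> nb v" for w
    using A_nb[of g w v] g that by simp
  have b: "b \<in> nb v" "b \<noteq> a" using a closed no_fixed by (auto simp: b_def)
  obtain c where c: "nb v = {a, b, c}" "c \<noteq> a" "c \<noteq> b" using nb_cases a b by metis
  have gc: "g \<langle>$\<rangle> c \<noteq> b" using c by (simp add: b_def apply_inj)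
  have "g \<langle>$\<rangle> c \<in> {a, b, c}" "g \<langle>$\<rangle> c \<noteq> c" using closed[of c] no_fixed[of c] c by auto
  then have "g \<langle>$\<rangle> c = a" using gc by auto
  moreover have "g \<langle>$\<rangle> b \<noteq> a" using \<open>g \<langle>$\<rangle> c = a\<close> c by (metis apply_inj)
  then have "g \<langle>$\<rangle> b = c" using closed[of b] no_fixed[of b] c by auto
  ultimately show ?thesis by (simp add: numeral_3_eq_3 flip: b_def)
qed

lemma power_A: "g \<in> A \<Longrightarrow> g ^ k \<in> A"
  by (induction k) (simp_all add: A_one A_mult)

lemma power_fixes: "g \<langle>$\<rangle> v = v \<Longrightarrow> (g ^ k) \<langle>$\<rangle> v = v"
  by (induction k) simp_all

lemma mult_fixes_iff: "g \<langle>$\<rangle> (h \<langle>$\<rangle> v) = h \<langle>$\<rangle> v \<longleftrightarrow> (inverse h * g * h) \<langle>$\<rangle> v = v"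
  by (metis apply_inverse_cancel apply_mult)

text \<open>The case in which arcs violate the axiom \<open>moves_succ\<close>; by
  \<open>arc_stabilizer_trivial\<close> the arc stabilisers are then trivial.\<close>

definition arc_rigid :: bool where
  "arc_rigid \<longleftrightarrow> (\<forall>g u v w. g \<in> A \<and> (u, v) \<in> E \<and> w \<in> nb v \<and> g \<langle>$\<rangle> u = u \<and> g \<langle>$\<rangle> v = v \<longrightarrow>
    g \<langle>$\<rangle> w = w)"

abbreviation arc_act :: "'a perm \<Rightarrow> 'a \<times> 'a \<Rightarrow> 'a \<times> 'a" where
  "arc_act p \<equiv> map_prod (apply p) (apply p)"

abbreviation arc_succ :: "'a \<times> 'a \<Rightarrow> ('a \<times> 'a) set" where
  "arc_succ e \<equiv> (case e of (u, v) \<Rightarrow> {(v, w) | w. w \<in> nb v - {u}})"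

text \<open>Together with vertex-transitivity this amounts to transitivity on arcs.\<close>

definition locally_transitive :: bool where
  "locally_transitive \<longleftrightarrow> (\<forall>v \<in> V. \<forall>a \<in> nb v. \<forall>b \<in> nb v. \<exists>g \<in> A. g \<langle>$\<rangle> v = v \<and> g \<langle>$\<rangle> a = b)"

text \<open>The darts of the arc-transitive case are the arcs, and the paths of darts are the
  non-backtracking walks.\<close>

lemma arc_darts:
  assumes loc: "locally_transitive"
    and flex: "\<not> arc_rigid"
  shows "dart_action A arc_act E arc_succ prod.swap"
proof -
  obtain g a v b where arc: "(a, v) \<in> E" "g \<in> A" "g \<langle>$\<rangle> a = a" "g \<langle>$\<rangle> v = v" "b \<in> nb v" "g \<langle>$\<rangle> b \<noteq> b"
    using flex unfolding arc_rigid_def by blast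
  have arc_trans: "\<exists>h \<in> A. h \<langle>$\<rangle> u = u' \<and> h \<langle>$\<rangle> v = v'" if arcs: "(u, v) \<in> E" "(u', v') \<in> E" for u v u' v'
  proof -
    obtain h where h: "h \<in> A" "h \<langle>$\<rangle> v = v'" using vertex_trans E_V arcs by blast
    have "h \<langle>$\<rangle> u \<in> nb v'" "u' \<in> nb v'"
      using arcs h A_nb[of h u v] nb_sym by (auto simp: nb_iff E_sym)
    then obtain k where "k \<in> A" "k \<langle>$\<rangle> v' = v'" "k \<langle>$\<rangle> (h \<langle>$\<rangle> u) = u'"
      using loc nb_V' unfolding locally_transitive_def by blast
    then show ?thesis using h by (intro bexI[of _ "k * h"]) (auto simp: A_mult)
  qed
  show ?thesis
  proof
    show "finite A" by (rule finite_A)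
    show "1 \<in> A" by (rule A_one)
    show "g * h \<in> A" if "g \<in> A" "h \<in> A" for g h using that by (rule A_mult)
    show "inverse g \<in> A" if "g \<in> A" for g using that by (rule A_inverse)
    show "arc_act 1 d = d" for d :: "'a \<times> 'a" by (cases d) simp
    show "arc_act (g * h) d =
        arc_act g (arc_act h d)" for g h and d :: "'a \<times> 'a"
      by (cases d) simp
    show "E \<noteq> {}" using arc by blast
    show "arc_act g d \<in> E" if "g \<in> A" "d \<in> E" for g d
      using that by (cases d) (simp add: A_edge)
    show "prod.swap d \<in> E" if "d \<in> E" for d using that by (cases d) (simp add: E_sym)
    show "prod.swap (prod.swap d) = d" for d :: "'a \<times> 'a" by simp
    show "arc_act g (prod.swap d) = prod.swap (arc_act g d)"
      for g and d :: "'a \<times> 'a" by (cases d) simp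
    show "arc_succ d \<subseteq> E" if "d \<in> E" for d
      by (cases d) (auto simp: nb_iff)
    show "card (arc_succ d) = 2" if "d \<in> E" for d
    proof (cases d)
      case (Pair u v)
      have "u \<in> nb v" "card (nb v) = 3" using that E_V Pair card_nb by (auto simp: nb_iff E_sym)
      then have "card (nb v - {u}) = 2" by simp
      moreover have "{(v, w) | w. w \<in> nb v - {u}} = Pair v ` (nb v - {u})" by auto
      ultimately show ?thesis by (simp add: Pair card_image inj_on_def)
    qed
    show "arc_act g e \<in> arc_succ (arc_act g d)"
      if "g \<in> A" "d \<in> E" "e \<in> arc_succ d" for g d e
      using that by (cases d) (auto simp: A_nb apply_inj)
    show "prod.swap d \<in> arc_succ (prod.swap e)"
      if "d \<in> E" "e \<in> arc_succ d" for d e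
      using that by (cases d) (auto simp: nb_iff E_sym)
    show "\<exists>g \<in> A. arc_act g d = e" if "d \<in> E" "e \<in> E" for d e
      using arc_trans that by (cases d; cases e) auto
    show "\<exists>g \<in> A. arc_act g d = d \<and> arc_act g e \<noteq> e"
      if de: "d \<in> E" "e \<in> arc_succ d" for d e
    proof -
      obtain u' v' w where d: "d = (u', v')" "e = (v', w)" "w \<in> nb v'" "w \<noteq> u'" "(u', v') \<in> E"
        using de by (cases d) auto
      obtain h where h: "h \<in> A" "h \<langle>$\<rangle> a = u'" "h \<langle>$\<rangle> v = v'" using arc_trans arc d by blast
      have u': "u' \<in> nb v'" using d by (simp add: nb_iff E_sym)
      define k where "k = h * g * inverse h"
      have ih: "inverse h \<langle>$\<rangle> u' = a" "inverse h \<langle>$\<rangle> v' = v" using h by auto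
      have k: "k \<in> A" "k \<langle>$\<rangle> u' = u'" "k \<langle>$\<rangle> v' = v'"
        using h arc ih by (auto simp: k_def A_mult A_inverse)
      \<comment> \<open>Fixing \<open>w\<close> besides \<open>u'\<close>, \<open>k\<close> would
        fix every neighbour of \<open>v'\<close>, in particular the image of \<open>b\<close> under
        \<open>h\<close>, which it moves because \<open>g\<close> moves \<open>b\<close>.\<close>
      have "k \<langle>$\<rangle> w \<noteq> w"
      proof
        assume "k \<langle>$\<rangle> w = w"
        then have "k \<langle>$\<rangle> (h \<langle>$\<rangle> b) = h \<langle>$\<rangle> b"
          using fixes_third[OF k(1,3) u' d(3)] d k A_nb[of h b v] h arc by auto
        then show False using arc by (simp add: k_def apply_inj)
      qed
      then show ?thesis using k d by (intro bexI[of _ k]) auto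
    qed
    show "g = 1" if g: "g \<in> A" "\<And>d. d \<in> E \<Longrightarrow> arc_act g d = d" for g
    proof (rule A_eqI[OF g(1)])
      fix u assume "u \<in> V"
      then have "nb u \<noteq> {}" using card_nb by fastforce
      then obtain w where "(u, w) \<in> E" by (auto simp: nb_iff)
      from g(2)[OF this] show "g \<langle>$\<rangle> u = u" by simp
    qed
    show "F = E" if F: "F \<subseteq> E" "F \<noteq> {}"
      "\<And>d e. d \<in> F \<Longrightarrow> e \<in> arc_succ d \<Longrightarrow> e \<in> F"
      "\<And>d. d \<in> F \<Longrightarrow> prod.swap d \<in> F" for F
    proof -
      \<comment> \<open>The successors of the reversed arc \<open>(u, v)\<close> are all arcs
        leaving \<open>v\<close> except \<open>(v, u)\<close>, which is in \<open>F\<close>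
        already.\<close>
      have out: "(v, w) \<in> F" if "(v, u) \<in> F" "w \<in> nb v" for u v w
        using F(3)[OF F(4)[OF that(1)], of "(v, w)"] that by (cases "w = u") auto
      have "{v. \<exists>u. (v, u) \<in> F} = V"
      proof (rule E_connected)
        show "{v. \<exists>u. (v, u) \<in> F} \<subseteq> V" using F(1) E_V by blast
        show "{v. \<exists>u. (v, u) \<in> F} \<noteq> {}" using F(2) by auto
        show "w \<in> {v. \<exists>u. (v, u) \<in> F}" if "v \<in> {v. \<exists>u. (v, u) \<in> F}" "(v, w) \<in> E" for v w
          using that out F(4)[of "(v, w)"] by (auto simp: nb_iff)
      qed
      then have "(v, w) \<in> F" if "(v, w) \<in> E" for v w
        using out E_V[OF that] that by (auto simp: nb_iff)
      with F(1) show ?thesis by auto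
    qed
  qed
qed

text \<open>
  In the other case of \<open>kernel_\<omega>\<close>, conjugation by \<open>x 0 * x N\<close>, which takes \<open>q (N - 1)\<close> to
  \<open>q (N + 1)\<close> and fixes \<open>q N\<close>, changes \<open>x 1\<close> by an element fixing all neighbours of \<open>q (N + 1)\<close>.
  But \<open>x 1\<close> fixes the neighbours of \<open>q (N - 1)\<close> and moves some of those of \<open>q (N + 1)\<close>.
\<close>

lemma arc_kernel:
  assumes "dart_action A arc_act E arc_succ prod.swap"
    and g: "g \<in> A" "(u, v) \<in> E" "w \<in> nb v" "w \<noteq> u"
      "g \<langle>$\<rangle> u = u" "g \<langle>$\<rangle> v = v" "g \<langle>$\<rangle> w = w"
  shows "g * g = 1"
proof -
  interpret dart_action A arc_act E arc_succ prod.swap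
    by fact
  obtain t \<omega> where "dart_line A arc_act E arc_succ prod.swap t \<omega>"
    by (rule obtain_line)
  then interpret dart_line A arc_act E arc_succ prod.swap t \<omega> .
  define q where "q i = fst (\<omega> i)" for i
  have \<omega>: "\<omega> i = (q i, q (i + 1))" for i
    using \<omega>_succ[of i] by (cases "\<omega> i") (auto simp: q_def)
  have q: "q (i + 1) \<in> nb (q i)" "q i \<in> nb (q (i + 1))" "q (i + 2) \<noteq> q i" for i
  proof -
    show "q (i + 1) \<in> nb (q i)" using \<omega>_D[of i] by (simp add: \<omega> nb_iff)
    then show "q i \<in> nb (q (i + 1))" by (simp add: nb_sym)
    show "q (i + 2) \<noteq> q i" using \<omega>_succ[of i] \<omega>[of "i + 1"] by (auto simp: \<omega> add.assoc)
  qed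
  \<comment> \<open>The arcs from \<open>\<omega> a\<close> to \<open>\<omega> b\<close> cover the
    vertices from \<open>q a\<close> to \<open>q (b + 1)\<close>, one more than there are
    arcs.\<close>
  have Fix_q: "h \<langle>$\<rangle> (q i) = q i" if "h \<in> Fix a b" "a \<le> i" "i \<le> b + 1" "a \<le> b" for h a b i
    using FixD[OF that(1), of i] FixD[OF that(1), of "i - 1"] that(2-) by (cases "i \<le> b") (auto simp: \<omega>)
  have "\<forall>g \<in> Fix (int n - 1) (int n). g * g = 1"
  proof (rule ccontr)
    assume "\<not> ?thesis"
    then have n: "2 < n" and z_mem: "x 0 * x (int n) * x 1 * x (int n) * x 0 * x 1 \<in> Fix (int n - 2) (int n + 1)"
      using kernel_\<omega> by auto
    define N z where "N = int n" and "z = x 0 * x N * x 1 * x N * x 0 * x 1"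
    have N: "2 < N" using n by (simp add: N_def)
    have z: "z \<in> Fix (N - 2) (N + 1)" using z_mem by (simp add: N_def z_def)
    have xx: "x i \<langle>$\<rangle> (x i \<langle>$\<rangle> u) = u" for i u
      by (simp add: x_involution flip: apply_mult)
    have x_q: "x i \<langle>$\<rangle> (q j) = q j" if "i \<le> j" "j \<le> i + N" for i j
      using Fix_q[OF x(1), of i j] that N by (simp add: N_def)
    have x0: "x 0 \<langle>$\<rangle> (q (N + 1)) \<noteq> q (N + 1)"
      using x_moves_right[of 0] x_q[of 0 N] N by (simp add: \<omega> N_def)
    have x1: "x 1 \<langle>$\<rangle> (q (N + 2)) \<noteq> q (N + 2)"
      using x_moves_right[of 1] x_q[of 1 "N + 1"] N by (simp add: \<omega> N_def add.commute)
    have xN: "x N \<langle>$\<rangle> (q (N - 1)) \<noteq> q (N - 1)"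
      using x_moves_left[of N] x_q[of N N] N by (simp add: \<omega> N_def)
    have nbN: "q (N - 1) \<in> nb (q N)" "q (N + 1) \<in> nb (q N)" "q (N - 1) \<noteq> q (N + 1)"
      using q(2)[of "N - 1"] q(1)[of N] q(3)[of "N - 1"] by (auto simp: add.commute)
    \<comment> \<open>\<open>x 0\<close> fixes \<open>q (N - 1)\<close> and moves
      \<open>q (N + 1)\<close>; \<open>x N\<close> does the opposite. Both images are the third
      neighbour of \<open>q N\<close>.\<close>
    have "x 0 \<langle>$\<rangle> (q (N + 1)) = x N \<langle>$\<rangle> (q (N - 1))"
    proof (rule nb_third[OF nbN])
      have A: "x i \<langle>$\<rangle> u \<in> nb (q N)" if "x i \<langle>$\<rangle> (q N) = q N" "u \<in> nb (q N)" for i u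
        using A_nb[OF x_G[of i], of u "q N"] that by simp
      show "x 0 \<langle>$\<rangle> (q (N + 1)) \<in> nb (q N)" "x N \<langle>$\<rangle> (q (N - 1)) \<in> nb (q N)"
        using A nbN x_q N by simp_all
      show "x 0 \<langle>$\<rangle> (q (N + 1)) \<noteq> q (N - 1)"
        using x_q[of 0 "N - 1"] nbN N apply_inj[of "x 0" "q (N + 1)" "q (N - 1)"] by auto
      show "x N \<langle>$\<rangle> (q (N - 1)) \<noteq> q (N + 1)"
        using x_q[of N "N + 1"] nbN N apply_inj[of "x N" "q (N - 1)" "q (N + 1)"] by simp
    qed (use x0 xN in auto)
    then have \<nu>: "x 0 \<langle>$\<rangle> (x N \<langle>$\<rangle> (q (N - 1))) = q (N + 1)" by (metis xx)
    \<comment> \<open>\<open>r\<close> is a second neighbour of \<open>q (N + 1)\<close>, besides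
      \<open>q N\<close>, fixed by \<open>z * x 1\<close>: this element is the conjugate of
      \<open>x 1\<close> by \<open>x 0 * x N\<close>, and \<open>x 1\<close> fixes
      \<open>q (N - 2)\<close> since \<open>2 < N\<close>. All neighbours of
      \<open>q (N + 1)\<close> are then fixed.\<close>
    define r where "r = x 0 \<langle>$\<rangle> (x N \<langle>$\<rangle> (q (N - 2)))"
    have r_nb: "r \<in> nb (q (N + 1))"
      using q(2)[of "N - 2"] A_nb[OF x_G[of 0], of "x N \<langle>$\<rangle> (q (N - 2))" "x N \<langle>$\<rangle> (q (N - 1))"]
        A_nb[OF x_G[of N], of "q (N - 2)" "q (N - 1)"] by (simp add: r_def \<nu>)
    have r_neq: "r \<noteq> q N"
    proof
      assume "r = q N"
      then have "x 0 \<langle>$\<rangle> (x N \<langle>$\<rangle> (q (N - 2))) = x 0 \<langle>$\<rangle> (x N \<langle>$\<rangle> (q N))"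
        using x_q N by (simp add: r_def)
      then show False using q(3)[of "N - 2"] by (simp add: apply_inj)
    qed
    have zx: "z * x 1 = x 0 * x N * x 1 * x N * x 0"
      by (simp add: z_def mult.assoc x_involution)
    have zx_r: "(z * x 1) \<langle>$\<rangle> r = r"
      unfolding zx using x_q[of 1 "N - 2"] N by (simp add: r_def xx)
    have z_q: "z \<langle>$\<rangle> (q i) = q i" if "N - 2 \<le> i" "i \<le> N + 2" for i
      using Fix_q[OF z] that by simp
    have zx_q: "(z * x 1) \<langle>$\<rangle> (q N) = q N" "(z * x 1) \<langle>$\<rangle> (q (N + 1)) = q (N + 1)"
      using z_q[of N] z_q[of "N + 1"] x_q[of 1 N] x_q[of 1 "N + 1"] N by simp_all
    have "(z * x 1) \<langle>$\<rangle> (q (N + 2)) = q (N + 2)"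
      using fixes_third[OF A_mult[OF Fix_G[OF z] x_G] zx_q(2) q(2) r_nb r_neq[symmetric] zx_q(1) zx_r]
        q(1)[of "N + 1"] by (simp add: add.assoc)
    then have "x 1 \<langle>$\<rangle> (q (N + 2)) = q (N + 2)"
      using z_q[of "N + 2"] N apply_inj[of z "x 1 \<langle>$\<rangle> (q (N + 2))" "q (N + 2)"] by simp
    with x1 show False by blast
  qed
  moreover obtain h where h: "h \<in> A" "arc_act h (u, v) = \<omega> (int n - 1)"
    "arc_act h (v, w) = \<omega> (int n)"
    using edge_transitive[OF g(2) _ \<omega>_D \<omega>_succ, of "(v, w)" "int n - 1"] g by auto
  have "h * g * inverse h \<in> Fix (int n - 1) (int n)"
  proof (rule FixI)
    fix i assume "int n - 1 \<le> i" "i \<le> int n"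
    then consider "i = int n - 1" | "i = int n" by linarith
    then show "arc_act (h * g * inverse h) (\<omega> i) = \<omega> i"
      using g by cases (auto simp flip: h(2,3))
  qed (use h g in \<open>simp add: A_mult A_inverse\<close>)
  ultimately have "(h * g * inverse h) * (h * g * inverse h) = 1" by blast
  then have "h * (g * g) * inverse h = 1" by (simp add: mult.assoc)
  then show ?thesis using conj_neq_1 by blast
qed

text \<open>Rigidity makes the set of vertices fixed together with all their neighbours closed under
  adjacency.\<close>

lemma arc_stabilizer_trivial:
  assumes arc_rigid and g: "g \<in> A" "(u, v) \<in> E" "g \<langle>$\<rangle> u = u" "g \<langle>$\<rangle> v = v"
  shows "g = 1"
proof (rule A_eqI[OF g(1)])
  define F where "F = {v \<in> V. g \<langle>$\<rangle> v = v \<and> (\<forall>w \<in> nb v. g \<langle>$\<rangle> w = w)}"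
  have fix_nb: "h \<langle>$\<rangle> w = w" if "h \<in> A" "(a, b) \<in> E" "w \<in> nb b" "h \<langle>$\<rangle> a = a" "h \<langle>$\<rangle> b = b" for h a b w
    using \<open>arc_rigid\<close> that unfolding arc_rigid_def by blast
  have "F = V"
  proof (rule E_connected)
    show "F \<subseteq> V" by (auto simp: F_def)
    have "v \<in> F" using fix_nb[OF g(1,2)] g E_V by (auto simp: F_def)
    then show "F \<noteq> {}" by blast
    show "b \<in> F" if "a \<in> F" "(a, b) \<in> E" for a b
      using that fix_nb[OF g(1) that(2)] E_V by (auto simp: F_def nb_iff)
  qed
  then show "g \<langle>$\<rangle> a = a" if "a \<in> V" for a using that by (auto simp: F_def)
qed

text \<open>An element fixing a neighbour lies in an arc stabiliser, which gives 4. Otherwise its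
  cube fixes all neighbours and has square 1, which gives 6.\<close>

lemma locally_transitive_order:
  assumes loc: locally_transitive and g: "g \<in> A" "v \<in> V" "g \<langle>$\<rangle> v = v"
  shows "g ^ 4 = 1 \<or> g ^ 6 = 1"
proof -
  have nb_fixed: "g ^ 4 = 1" if "a \<in> nb v" "g \<langle>$\<rangle> a = a" for a
  proof (cases arc_rigid)
    case True
    then have "g = 1"
      using arc_stabilizer_trivial[of g a v] that g by (simp add: nb_iff E_sym)
    then show ?thesis by simp
  next
    case False
    then interpret dart_action A arc_act E arc_succ prod.swap
      using arc_darts[OF loc] by simp
    show ?thesis using exponent_4[OF g(1), of "(a, v)"] that g by (simp add: nb_iff E_sym)
  qed
  show ?thesis
  proof (cases "\<exists>a \<in> nb v. g \<langle>$\<rangle> a = a")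
    case False
    have "nb v \<noteq> {}" using card_nb[OF g(2)] by auto
    then obtain a where a: "a \<in> nb v" by blast
    define b where "b = g \<langle>$\<rangle> a"
    have b: "b \<in> nb v" "b \<noteq> a" using A_nb[OF g(1), of a v] a g False by (auto simp: b_def)
    have "(g ^ 3) \<langle>$\<rangle> u = u" if "u \<in> nb v" for u
      using cube_fixes[OF g(1,3) _ that] False by blast
    then have g3: "g ^ 3 \<in> A" "(g ^ 3) \<langle>$\<rangle> v = v" "(g ^ 3) \<langle>$\<rangle> a = a" "(g ^ 3) \<langle>$\<rangle> b = b"
      using g a b by (simp_all add: power_A power_fixes)
    have "g ^ 3 * g ^ 3 = 1"
    proof (cases arc_rigid)
      case True
      then have "g ^ 3 = 1"
        using arc_stabilizer_trivial[of "g ^ 3" a v] g3 a by (simp add: nb_iff E_sym)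
      then show ?thesis by simp
    next
      case False
      then have "dart_action A arc_act E arc_succ prod.swap"
        using arc_darts[OF loc] by simp
      then show ?thesis using arc_kernel[of "g ^ 3" a v b] g3 a b by (auto simp: nb_iff E_sym)
    qed
    then show ?thesis by (simp flip: power_add)
  qed (use nb_fixed in blast)
qed

text \<open>
  Here the stabiliser of a vertex fixes exactly one of its neighbours, its mate. The darts are the
  vertices, with the mate as reversal.
\<close>

lemma not_locally_transitive_order:
  assumes loc: "\<not> locally_transitive" and g: "g \<in> A" "v \<in> V" "g \<langle>$\<rangle> v = v"
  shows "g ^ 4 = 1"
proof (cases "\<forall>h \<in> A. \<forall>v. \<forall>w \<in> nb v. h \<langle>$\<rangle> v = v \<longrightarrow> h \<langle>$\<rangle> w = w")
  case True
  have "nb v \<noteq> {}" using card_nb[OF g(2)] by auto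
  then obtain u where "u \<in> nb v" by blast
  then have "(u, v) \<in> E" by (simp add: nb_iff E_sym)
  moreover have "g \<langle>$\<rangle> u = u" using True g \<open>u \<in> nb v\<close> by blast
  moreover have arc_rigid using True unfolding arc_rigid_def by blast
  ultimately have "g = 1" using arc_stabilizer_trivial g by blast
  then show ?thesis by simp
next
  case False
  then obtain h0 v0 w0 where h0: "h0 \<in> A" "w0 \<in> nb v0" "h0 \<langle>$\<rangle> v0 = v0" "h0 \<langle>$\<rangle> w0 \<noteq> w0" by blast
  define St where "St v = {h \<in> A. h \<langle>$\<rangle> v = v}" for v
  obtain v1 a1 b1 where 1: "v1 \<in> V" "a1 \<in> nb v1" "b1 \<in> nb v1" "\<And>h. h \<in> St v1 \<Longrightarrow> h \<langle>$\<rangle> a1 \<noteq> b1"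
    using loc by (auto simp: locally_transitive_def St_def)
  have conj: "k * h * inverse k \<in> St (k \<langle>$\<rangle> v)" if "k \<in> A" "h \<in> St v" for k h v
    using that by (auto simp: St_def A_mult A_inverse)
  have St_mult: "h * k \<in> St v" if "h \<in> St v" "k \<in> St v" for h k v
    using that by (auto simp: St_def A_mult)
  have St_inverse: "inverse h \<in> St v" if "h \<in> St v" for h v
    using that apply_inverse_cancel(1)[of h v] by (simp add: St_def A_inverse)
  have unique: "\<exists>z. z \<in> nb v \<and> (\<forall>h \<in> St v. h \<langle>$\<rangle> z = z) \<and> (\<exists>h \<in> St v. \<forall>a \<in> nb v - {z}. h \<langle>$\<rangle> a \<noteq> a)"
    if v: "v \<in> V" for v
  proof -
    have "v0 \<in> V" using h0 nb_V' by blast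
    then obtain k where k: "k \<in> A" "k \<langle>$\<rangle> v0 = v" using vertex_trans v by blast
    define h u where "h = k * h0 * inverse k" and "u = k \<langle>$\<rangle> w0"
    have h: "h \<in> St v" using conj[of k h0 v0] k h0 by (auto simp: h_def St_def)
    have hA: "h \<in> A" "h \<langle>$\<rangle> v = v" using h by (auto simp: St_def)
    have u: "u \<in> nb v" "h \<langle>$\<rangle> u \<noteq> u"
      using A_nb[OF k(1), of w0 v0] k h0 by (auto simp: u_def h_def apply_inj)
    have hu: "h \<langle>$\<rangle> u \<in> nb v" using A_nb[OF hA(1), of u v] u hA by simp
    obtain z where z: "nb v = {u, h \<langle>$\<rangle> u, z}" "z \<noteq> u" "z \<noteq> h \<langle>$\<rangle> u"
      using nb_cases[OF u(1) hu u(2)[symmetric]] by blast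
    obtain k1 where k1: "k1 \<in> A" "k1 \<langle>$\<rangle> v1 = v" using vertex_trans v 1 by blast
    have not_trans: "\<exists>a \<in> nb v. \<exists>b \<in> nb v. \<forall>f \<in> St v. f \<langle>$\<rangle> a \<noteq> b"
    proof (intro bexI ballI)
      fix f assume f: "f \<in> St v"
      have "inverse k1 \<langle>$\<rangle> v = v1" using k1 by auto
      then have "inverse k1 * f * k1 \<in> St v1" using conj[OF A_inverse[OF k1(1)] f] by (simp add: perm.inverse_inverse)
      from 1(4)[OF this] show "f \<langle>$\<rangle> (k1 \<langle>$\<rangle> a1) \<noteq> k1 \<langle>$\<rangle> b1" by auto
    qed (use A_nb[OF k1(1)] k1 1 in auto)
    \<comment> \<open>An element moving \<open>z\<close> would, together with \<open>h\<close>, take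
      every neighbour to \<open>u\<close>, and the stabiliser would be transitive on the
      neighbours.\<close>
    have z_fixed: "f \<langle>$\<rangle> z = z" if f: "f \<in> St v" for f
    proof (rule ccontr)
      assume fz: "f \<langle>$\<rangle> z \<noteq> z"
      have fA: "f \<in> A" "f \<langle>$\<rangle> v = v" using f by (auto simp: St_def)
      have "f \<langle>$\<rangle> z \<in> nb v" using A_nb[OF fA(1), of z v] fA z by simp
      then have "\<exists>f' \<in> St v. f' \<langle>$\<rangle> z = u"
      proof (cases "f \<langle>$\<rangle> z = u")
        case False
        then have "f \<langle>$\<rangle> z = h \<langle>$\<rangle> u" using \<open>f \<langle>$\<rangle> z \<in> nb v\<close> fz z by auto
        then have "(inverse h * f) \<langle>$\<rangle> z = u" by simp
        then show ?thesis using St_mult[OF St_inverse[OF h] f] by blast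
      qed (use f in blast)
      moreover have "1 \<in> St v" by (simp add: St_def A_one)
      moreover have "inverse h \<langle>$\<rangle> (h \<langle>$\<rangle> u) = u" by simp
      ultimately have to_u: "\<exists>f' \<in> St v. f' \<langle>$\<rangle> a = u" if "a \<in> nb v" for a
        using that z St_inverse[OF h] by (metis apply_one empty_iff id_apply insert_iff)
      have "\<exists>f' \<in> St v. f' \<langle>$\<rangle> a = b" if ab: "a \<in> nb v" "b \<in> nb v" for a b
      proof -
        obtain f1 f2 where f12: "f1 \<in> St v" "f1 \<langle>$\<rangle> a = u" "f2 \<in> St v" "f2 \<langle>$\<rangle> b = u" using to_u ab by blast
        then have "(inverse f2 * f1) \<langle>$\<rangle> a = b" by (metis apply_inverse_cancel(1) apply_mult)
        then show ?thesis using St_mult[OF St_inverse[OF f12(3)] f12(1)] by blast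
      qed
      with not_trans show False by blast
    qed
    have "h \<langle>$\<rangle> (h \<langle>$\<rangle> u) \<noteq> h \<langle>$\<rangle> u" using u by (simp add: apply_inj)
    then show ?thesis using z z_fixed h u(2) by (intro exI[of _ z]) auto
  qed
  then obtain mate where mate: "\<And>v. v \<in> V \<Longrightarrow> mate v \<in> nb v"
    "\<And>v h. v \<in> V \<Longrightarrow> h \<in> St v \<Longrightarrow> h \<langle>$\<rangle> (mate v) = mate v"
    "\<And>v. v \<in> V \<Longrightarrow> \<exists>h \<in> St v. \<forall>a \<in> nb v - {mate v}. h \<langle>$\<rangle> a \<noteq> a"
    by metis
  have mate_eq: "mate v = z" if "z \<in> nb v" "\<And>h. h \<in> St v \<Longrightarrow> h \<langle>$\<rangle> z = z" for v z
    using mate(3)[of v] that nb_V' by fastforce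
  have mate_V: "mate v \<in> V" if "v \<in> V" for v using mate(1) nb_V that by blast
  have act_mate: "h \<langle>$\<rangle> (mate v) = mate (h \<langle>$\<rangle> v)" if h: "h \<in> A" "v \<in> V" for h v
  proof (rule mate_eq[symmetric])
    show "h \<langle>$\<rangle> (mate v) \<in> nb (h \<langle>$\<rangle> v)" using A_nb h mate by blast
    show "k \<langle>$\<rangle> (h \<langle>$\<rangle> (mate v)) = h \<langle>$\<rangle> (mate v)" if "k \<in> St (h \<langle>$\<rangle> v)" for k
    proof -
      have "inverse h * k * h \<in> St v" using conj[OF A_inverse[OF h(1)] that] by (simp add: perm.inverse_inverse)
      then have "(inverse h * k * h) \<langle>$\<rangle> (mate v) = mate v" using mate(2)[OF h(2)] by blast
      then show ?thesis by (simp only: mult_fixes_iff)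
    qed
  qed
  \<comment> \<open>One inclusion is clear and vertex-transitivity makes both stabilisers equally
    large. So \<open>v\<close> is a neighbour of \<open>mate v\<close> fixed by the stabiliser of
    \<open>mate v\<close>, that is, its mate.\<close>
  have St_mate: "St (mate v) = St v" if v: "v \<in> V" for v
  proof -
    have fin: "finite (St u)" for u using finite_A by (simp add: St_def)
    obtain k where k: "k \<in> A" "k \<langle>$\<rangle> v = mate v" using vertex_trans v mate_V by blast
    have "St v \<subseteq> St (mate v)" using mate(2)[OF v] by (auto simp: St_def)
    moreover have "card (St (mate v)) \<le> card (St v)"
    proof (rule card_inj_on_le[of "\<lambda>h. inverse k * h * k"])
      show "inj_on (\<lambda>h. inverse k * h * k) (St (mate v))"
        by (rule inj_onI) (simp add: perm.left_cancel perm.right_cancel mult.assoc)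
      have "inverse k \<langle>$\<rangle> (mate v) = v" using k(2) by (metis apply_inverse_cancel(1))
      then show "(\<lambda>h. inverse k * h * k) ` St (mate v) \<subseteq> St v"
        using conj[OF A_inverse[OF k(1)], of _ "mate v"] by (auto simp: perm.inverse_inverse)
    qed (rule fin)
    ultimately show ?thesis using card_seteq fin by metis
  qed
  have mate_mate: "mate (mate v) = v" if v: "v \<in> V" for v
    using mate(1)[OF v] St_mate[OF v] by (intro mate_eq) (auto simp: nb_sym St_def)
  \<comment> \<open>The vertex \<open>d\<close> stands for the edge from \<open>d\<close> to its
    mate; a successor is the far end of one of the two remaining edges at the mate.\<close>
  interpret dart_action A "apply" V "\<lambda>v. nb (mate v) - {v}" mate
  proof
    show "finite A" by (rule finite_A)
    show "1 \<in> A" by (rule A_one)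
    show "g * h \<in> A" if "g \<in> A" "h \<in> A" for g h using that by (rule A_mult)
    show "inverse g \<in> A" if "g \<in> A" for g using that by (rule A_inverse)
    show "1 \<langle>$\<rangle> d = d" for d :: 'a by simp
    show "(g * h) \<langle>$\<rangle> d = g \<langle>$\<rangle> (h \<langle>$\<rangle> d)" for g h and d :: 'a by simp
    show "V \<noteq> {}" by (rule V_nonempty)
    show "g \<langle>$\<rangle> d \<in> V" if "g \<in> A" "d \<in> V" for g d using that by (simp add: A_V)
    show "mate d \<in> V" if "d \<in> V" for d using that by (rule mate_V)
    show "mate (mate d) = d" if "d \<in> V" for d using that by (rule mate_mate)
    show "g \<langle>$\<rangle> (mate d) = mate (g \<langle>$\<rangle> d)" if "g \<in> A" "d \<in> V" for g d using that by (rule act_mate)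
    show "nb (mate d) - {d} \<subseteq> V" if "d \<in> V" for d using nb_V by auto
    show "card (nb (mate d) - {d}) = 2" if d: "d \<in> V" for d
      using mate(1)[OF mate_V[OF d]] card_nb[OF mate_V[OF d]] mate_mate[OF d] by simp
    show "g \<langle>$\<rangle> e \<in> nb (mate (g \<langle>$\<rangle> d)) - {g \<langle>$\<rangle> d}" if "g \<in> A" "d \<in> V" "e \<in> nb (mate d) - {d}" for g d e
      using that A_nb[OF that(1), of e "mate d"] by (simp add: act_mate[symmetric] apply_inj)
    show "mate d \<in> nb (mate (mate e)) - {mate e}" if de: "d \<in> V" "e \<in> nb (mate d) - {d}" for d e
    proof -
      have e: "e \<in> V" using de nb_V by blast
      then show ?thesis using de mate_mate[OF e] mate_mate[OF de(1)] by (auto simp: nb_sym) 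
    qed
    show "\<exists>g \<in> A. g \<langle>$\<rangle> d = e" if "d \<in> V" "e \<in> V" for d e using that by (rule vertex_trans)
    show "\<exists>g \<in> A. g \<langle>$\<rangle> d = d \<and> g \<langle>$\<rangle> e \<noteq> e" if de: "d \<in> V" "e \<in> nb (mate d) - {d}" for d e
      using mate(3)[OF mate_V[OF de(1)]] de mate_mate[OF de(1)] St_mate[OF de(1)] by (auto simp: St_def)
    show "g = 1" if "g \<in> A" "\<And>d. d \<in> V \<Longrightarrow> g \<langle>$\<rangle> d = d" for g using that by (rule A_eqI)
    show "F = V" if F: "F \<subseteq> V" "F \<noteq> {}" "\<And>d e. d \<in> F \<Longrightarrow> e \<in> nb (mate d) - {d} \<Longrightarrow> e \<in> F"
      "\<And>d. d \<in> F \<Longrightarrow> mate d \<in> F" for F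
    proof (rule E_connected[OF F(1,2)])
      fix u v assume u: "u \<in> F" "(u, v) \<in> E"
      show "v \<in> F"
      proof (cases "v = mate u")
        case False
        then show ?thesis
          using F(3)[OF F(4)[OF u(1)], of v] u mate_mate[of u] F(1) by (auto simp: nb_iff)
      qed (use F(4) u in simp)
    qed
  qed
  show ?thesis using exponent_4 g by blast
qed

theorem stabilizer_order:
  assumes "g \<in> A" "v \<in> V" "g \<langle>$\<rangle> v = v"
  shows "g ^ 4 = 1 \<or> g ^ 6 = 1"
  using locally_transitive_order not_locally_transitive_order assms by blast

end

section \<open>Orders in the vertex stabiliser\<close>

text \<open>Replaces the value \<open>undefined\<close> off \<open>V\<close> by the identity, as a
  \<open>perm\<close> acts on the whole type.\<close>

definition perm_of :: "'a set \<Rightarrow> ('a \<Rightarrow> 'a) \<Rightarrow> 'a perm" where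
  "perm_of V f = Perm (\<lambda>x. if x \<in> V then f x else x)"

lemma apply_perm_of:
  assumes "finite V" "f \<in> Bij V"
  shows "perm_of V f \<langle>$\<rangle> x = (if x \<in> V then f x else x)"
proof -
  let ?p = "\<lambda>x. if x \<in> V then f x else x"
  have "bij_betw f V V" using assms by (simp add: Bij_def)
  then have "bij_betw ?p V V" by (subst bij_betw_cong) auto
  moreover have "bij_betw ?p (- V) (- V)" by (subst bij_betw_cong[of _ _ id]) auto
  ultimately have "bij ?p" using bij_betw_combine[of ?p V V "- V" "- V"] by simp
  moreover have "finite {x. ?p x \<noteq> x}" using assms(1) by (rule rev_finite_subset) auto
  ultimately have "apply (Perm ?p) = ?p" by (intro Perm_inverse) simp
  then show ?thesis by (simp add: perm_of_def)
qed

lemma perm_of_graph_perms: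
  assumes "pair_graph G" "f \<in> graph_auts G"
  shows "perm_of (pverts G) f \<in> graph_perms (pverts G) (parcs G)"
proof -
  interpret pair_graph G by fact
  have f: "f \<in> Bij (pverts G)" using assms by (simp add: graph_auts_def)
  note p = apply_perm_of[OF pair_finite_verts f]
  have fV: "f u \<in> pverts G" if "u \<in> pverts G" for u using f that Bij_imp_funcset by blast
  have "(perm_of (pverts G) f \<langle>$\<rangle> u, perm_of (pverts G) f \<langle>$\<rangle> v) \<in> parcs G \<longleftrightarrow> (u, v) \<in> parcs G" for u v
  proof (cases "u \<in> pverts G \<and> v \<in> pverts G")
    case True
    then show ?thesis using assms(2) by (simp add: p graph_auts_def)
  next
    case False
    then show ?thesis using in_arcsD1 in_arcsD2 fV by (auto simp: p)
  qed
  then show ?thesis by (simp add: graph_perms_def p)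
qed

lemma cubic_graph_pair_graph:
  assumes "pair_graph G" "connected (with_proj G)" "k_valent 3 G" "vertex_transitive G"
  shows "cubic_graph (pverts G) (parcs G)"
proof -
  interpret pair_graph G by fact
  have conn: "pverts G \<noteq> {}"
    "\<And>u v. u \<in> pverts G \<Longrightarrow> v \<in> pverts G \<Longrightarrow> (u, v) \<in> rtrancl_on (pverts G) ((parcs G)\<^sup>s)"
    using assms(2) by (auto simp: connected_conv)
  have sym: "(parcs G)\<^sup>s = parcs G"
    by (auto simp: symcl_def arcs_symmetric)
  show ?thesis
  proof
    show "finite (pverts G)" by (rule pair_finite_verts)
    show "pverts G \<noteq> {}" by (rule conn)
    show "u \<in> pverts G \<and> v \<in> pverts G" if "(u, v) \<in> parcs G" for u v
      using that in_arcsD1 in_arcsD2 by blast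
    show "(v, u) \<in> parcs G" if "(u, v) \<in> parcs G" for u v using that by (rule arcs_symmetric)
    show "card (parcs G `` {v}) = 3" if "v \<in> pverts G" for v
    proof -
      have "out_arcs (with_proj G) v = Pair v ` (parcs G `` {v})"
        by (auto simp: out_arcs_def)
      then have "out_degree (with_proj G) v = card (parcs G `` {v})"
        by (simp add: out_degree_def card_image inj_on_def)
      then show ?thesis using assms(3) that by (simp add: k_valent_def)
    qed
    show "F = pverts G" if F: "F \<subseteq> pverts G" "F \<noteq> {}" "\<And>u v. u \<in> F \<Longrightarrow> (u, v) \<in> parcs G \<Longrightarrow> v \<in> F" for F
    proof -
      obtain u where u: "u \<in> F" using F(2) by blast
      have "v \<in> F" if "v \<in> pverts G" for v
      proof -
        have "(u, v) \<in> rtrancl_on (pverts G) (parcs G)" using conn(2)[of u v] u F(1) that sym by auto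
        then show ?thesis by (induction rule: rtrancl_on_induct) (use u F(3) in auto)
      qed
      with F(1) show ?thesis by blast
    qed
    show "\<exists>g \<in> graph_perms (pverts G) (parcs G). g \<langle>$\<rangle> u = v" if uv: "u \<in> pverts G" "v \<in> pverts G" for u v
    proof -
      obtain f where f: "f \<in> graph_auts G" "f u = v"
        using assms(4) uv unfolding vertex_transitive_def by (fastforce simp: Aut_def)
      then have "perm_of (pverts G) f \<langle>$\<rangle> u = v"
        using uv by (simp add: apply_perm_of pair_finite_verts graph_auts_def)
      then show ?thesis using perm_of_graph_perms[OF assms(1) f(1)] by blast
    qed
  qed
qed

text \<open>Transfers orders: if a power of \<open>perm_of (pverts G) f\<close> is 1, the same power
  of \<open>f\<close> is the identity on the vertices, which is the unit of the stabiliser.\<close>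

lemma Aut_stab_power:
  assumes "finite (pverts G)" "v \<in> pverts G" "f \<in> carrier (Aut_stab G v)"
  shows "f [^]\<^bsub>Aut_stab G v\<^esub> k = (\<lambda>u \<in> pverts G. (perm_of (pverts G) f ^ k) \<langle>$\<rangle> u)"
proof (induction k)
  case 0
  show ?case by (simp add: Aut_stab_def Aut_def BijGroup_def nat_pow_def restrict_def)
next
  case (Suc k)
  interpret group "Aut_stab G v" by (rule group_Aut_stab[OF assms(2)])
  have Bij: "h \<in> Bij (pverts G)" if "h \<in> carrier (Aut_stab G v)" for h
    using that by (simp add: Aut_stab_def Aut_def stabilizer_def graph_auts_def)
  have "f [^]\<^bsub>Aut_stab G v\<^esub> Suc k = compose (pverts G) (f [^]\<^bsub>Aut_stab G v\<^esub> k) f"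
    using Bij[OF nat_pow_closed[OF assms(3)]] Bij[OF assms(3)]
    by (simp add: Aut_stab_def Aut_def BijGroup_def)
  also have "\<dots> = (\<lambda>u \<in> pverts G. (perm_of (pverts G) f ^ Suc k) \<langle>$\<rangle> u)"
    unfolding Suc power_Suc2
    using Bij[OF assms(3)] Bij_imp_funcset[OF Bij[OF assms(3)]] apply_perm_of[OF assms(1) Bij[OF assms(3)]]
    by (auto simp: compose_def apply_times fun_eq_iff restrict_def)
  finally show ?case .
qed

theorem theorem1p5:
  fixes G :: "'a pair_pre_digraph"
  assumes "pair_graph G"
    and "connected (with_proj G)"
    and "k_valent 3 G"
    and "vertex_transitive G"
  shows "\<forall>v \<in> pverts G.
           (\<forall>g \<in> carrier (Aut_stab G v). group.ord (Aut_stab G v) g \<le> 6) \<and>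
           meo (Aut_stab G v) \<le> 6"
proof
  fix v assume v: "v \<in> pverts G"
  interpret cubic_graph "pverts G" "parcs G" using assms by (rule cubic_graph_pair_graph)
  interpret stab: group "Aut_stab G v" by (rule group_Aut_stab[OF v])
  have ord: "stab.ord g \<le> 6" if g: "g \<in> carrier (Aut_stab G v)" for g
  proof -
    have g': "g \<in> graph_auts G" "g v = v"
      using g by (auto simp: Aut_stab_def Aut_def stabilizer_def)
    then have "perm_of (pverts G) g \<langle>$\<rangle> v = v"
      using v by (simp add: apply_perm_of finite_V graph_auts_def)
    then have "perm_of (pverts G) g ^ 4 = 1 \<or> perm_of (pverts G) g ^ 6 = 1"
      using stabilizer_order perm_of_graph_perms[OF assms(1) g'(1)] v by blast
    moreover have "stab.ord g dvd k" if "perm_of (pverts G) g ^ k = 1" for k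
    proof -
      have "g [^]\<^bsub>Aut_stab G v\<^esub> k = \<one>\<^bsub>Aut_stab G v\<^esub>"
        by (simp add: Aut_stab_power[OF finite_V v g] that)
          (simp add: Aut_stab_def Aut_def BijGroup_def restrict_def)
      then show ?thesis using stab.pow_eq_id[OF g] by simp
    qed
    ultimately show ?thesis by (fastforce dest: dvd_imp_le)
  qed
  moreover have "meo (Aut_stab G v) \<le> 6"
  proof -
    have "carrier (Aut_stab G v) \<noteq> {}" using stab.one_closed by blast
    then show ?thesis
      unfolding meo_def using ord finite_Aut_stab[OF finite_V] by (subst Max_le_iff) auto
  qed
  ultimately show "(\<forall>g \<in> carrier (Aut_stab G v). stab.ord g \<le> 6) \<and> meo (Aut_stab G v) \<le> 6"
    by blast
qed

end
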